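(* Let $f=\nu Z.(a\wedge \mathsf{X}^{\geq 0.5}Z)$ for an atomic proposition $a$. Then there is no PCTL formula $g$ such that $[\![g]\!]_M=[\![f]\!]_M$ for every Markov chain $M$.
   Context: Fix a countable set $\mathcal{A}$ of atomic propositions and a countable set $\mathcal{Z}$ of variables. A Markov chain is $M=(S,\mathbf{T},L)$ with $S$ finite, $\mathbf{T}:S\times S\to[0,1]$ row-stochastic, $L:S\to2^{\mathcal{A}}$. A path is an infinite sequence $s_0s_1\dots$ with $\mathbf{T}(s_i,s_{i+1})>0$; from a state $s$ there is the standard probability measure $\Pr_{M,s}$ on paths starting in $s$, with $\Pr_{M,s}(\text{paths with prefix }s_0\dots s_n)=\prod_{i<n}\mathbf{T}(s_i,s_{i+1})$ if $s_0=s$. PμTL formulas: $f::=\top\mid\bot\mid a\mid\neg a\mid Z\mid \mathsf{X}^{\sim p}f\mid f\wedge f\mid f\vee f\mid \mu Z.f\mid \nu Z.f$ (${\sim}\in\{>,\geq\}$, $p\in[0,1]$), with semantics under an assignment $e:\mathcal{Z}\to2^S$: $[\![\top]\!]=S$, $[\![\bot]\!]=\emptyset$, $[\![a]\!]=\{s:a\in L(s)\}$, $[\![\neg a]\!]=\{s:a\notin L(s)\}$, $[\![Z]\!]=e(Z)$, $[\![\mathsf{X}^{\sim p}f]\!]=\{s:\sum_{s'\in[\![f]\!]}\mathbf{T}(s,s')\sim p\}$, $\wedge,\vee$ as $\cap,\cup$, $\mu Z.f$ the least and $\nu Z.f$ the greatest fixpoint of $S'\mapsto[\![f]\!]_M(e[Z\mapsto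 S'])$. For closed formulas write $[\![f]\!]_M$. PCTL formulas: $g::=\top\mid\bot\mid a\mid\neg a\mid \mathsf{X}^{\sim p}g\mid g\wedge g\mid g\vee g\mid g\,\mathsf{U}^{\sim p}g\mid g\,\mathsf{R}^{\sim p}g$, with the same clauses for $\top,\bot,a,\neg a,\mathsf{X},\wedge,\vee$, and $[\![g_1\mathsf{U}^{\sim p}g_2]\!]_M=\{s:\Pr_{M,s}\{\pi:\pi\models g_1\mathsf{U}g_2\}\sim p\}$, $[\![g_1\mathsf{R}^{\sim p}g_2]\!]_M=\{s:\Pr_{M,s}\{\pi:\pi\models g_1\mathsf{R}g_2\}\sim p\}$, where for $\pi=s_0s_1\dots$: $\pi\models g_1\mathsf{U}g_2$ iff some $i$ has $s_i\in[\![g_2]\!]$ and $s_j\in[\![g_1]\!]$ for all $j<i$; $\pi\models g_1\mathsf{R}g_2$ iff $\pi\models g_2\mathsf{U}(g_1\wedge g_2)$ or $s_j\in[\![g_2]\!]$ for all $j$. *)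

theory Defs
  imports "HOL-Probability.Probability"
begin

section \<open>Markov chains\<close>

text \<open>
  The state space is a finite carrier set, so that one type \<open>'s\<close> accommodates chains of
  all sizes; over \<open>nat\<close> every Markov chain occurs up to isomorphism.
\<close>

record ('s, 'a) mchain =
  states :: "'s set"
  tprob :: "'s \<Rightarrow> 's \<Rightarrow> real"
  label :: "'s \<Rightarrow> 'a set"

definition markov_chain :: "('s, 'a) mchain \<Rightarrow> bool" where
  "markov_chain M \<longleftrightarrow> finite (states M) \<and>
     (\<forall>s\<in>states M. \<forall>t\<in>states M. tprob M s t \<in> {0..1}) \<and>
     (\<forall>s\<in>states M. (\<Sum>t\<in>states M. tprob M s t) = 1)"

definition paths :: "('s, 'a) mchain \<Rightarrow> 's \<Rightarrow> (nat \<Rightarrow> 's) set" where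
  "paths M s = {\<pi>. range \<pi> \<subseteq> states M \<and> \<pi> 0 = s \<and> (\<forall>i. tprob M (\<pi> i) (\<pi> (Suc i)) > 0)}"

text \<open>
  The measure lives on all state sequences, with the product \<open>\<sigma>\<close>-algebra; \<open>Pr\<close> below
  restricts events to paths. Existence and uniqueness are proved in
  \<open>ex1_path_measure\<close>.
\<close>

definition is_path_measure :: "('s, 'a) mchain \<Rightarrow> 's \<Rightarrow> (nat \<Rightarrow> 's) measure \<Rightarrow> bool" where
  "is_path_measure M s P \<longleftrightarrow> prob_space P \<and>
     sets P = sets (\<Pi>\<^sub>M i\<in>UNIV. count_space (states M)) \<and>
     (\<forall>n x. range x \<subseteq> states M \<longrightarrow>
        measure P {\<pi>\<in>space P. \<forall>i\<le>n. \<pi> i = x i} =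
        (if x 0 = s then \<Prod>i<n. tprob M (x i) (x (Suc i)) else 0))"

definition path_measure :: "('s, 'a) mchain \<Rightarrow> 's \<Rightarrow> (nat \<Rightarrow> 's) measure" where
  "path_measure M s = (THE P. is_path_measure M s P)"

definition Pr :: "('s, 'a) mchain \<Rightarrow> 's \<Rightarrow> ((nat \<Rightarrow> 's) \<Rightarrow> bool) \<Rightarrow> real" where
  "Pr M s \<phi> = measure (path_measure M s) {\<pi>\<in>paths M s. \<phi> \<pi>}"

lemma path_measure_unique:
  assumes fin: "finite (states M)" and P: "is_path_measure M s P" and Q: "is_path_measure M s Q"
  shows "P = Q"
proof (rule measure_eqI_PiM_infinite[where I=UNIV and M="\<lambda>_. count_space (states M)"])
  let ?S = "states M" let ?N = "\<lambda>_::nat. count_space (states M)"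
  interpret P: prob_space P using P by (simp add: is_path_measure_def)
  interpret Q: prob_space Q using Q by (simp add: is_path_measure_def)
  show sP: "sets P = sets (PiM UNIV ?N)" and sQ: "sets Q = sets (PiM UNIV ?N)"
    using P Q by (auto simp: is_path_measure_def)
  have spP: "space P = UNIV \<rightarrow>\<^sub>E ?S" "space Q = UNIV \<rightarrow>\<^sub>E ?S"
    using sets_eq_imp_space_eq[OF sP] sets_eq_imp_space_eq[OF sQ] by (auto simp: space_PiM)
  show "finite_measure P" by unfold_locales
  fix A and J :: "nat set" assume J: "finite J" "J \<subseteq> UNIV" and A: "\<And>i. i \<in> J \<Longrightarrow> A i \<in> sets (?N i)"
  obtain n where n: "J \<subseteq> {..n}" using J finite_nat_iff_bounded_le by blast
  let ?I = "{..n}"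
  have cs: "PiM ?I ?N = count_space (PiE ?I (\<lambda>_. ?S))"
    using fin by (intro count_space_PiM_finite) (auto intro: countable_finite)
  have fPi: "finite (PiE ?I (\<lambda>_. ?S))" using fin by (intro finite_PiE) auto
  have meas: "(\<lambda>x. restrict x ?I) \<in> measurable P (PiM ?I ?N)"
             "(\<lambda>x. restrict x ?I) \<in> measurable Q (PiM ?I ?N)"
    using measurable_restrict_subset[of ?I UNIV ?N]
    by (simp_all add: measurable_cong_sets[OF sP refl] measurable_cong_sets[OF sQ refl])
  have eq: "distr P (PiM ?I ?N) (\<lambda>x. restrict x ?I) = distr Q (PiM ?I ?N) (\<lambda>x. restrict x ?I)"
  proof (rule measure_eqI_finite)
    show "sets (distr P (PiM ?I ?N) (\<lambda>x. restrict x ?I)) = Pow (PiE ?I (\<lambda>_. ?S))"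
         "sets (distr Q (PiM ?I ?N) (\<lambda>x. restrict x ?I)) = Pow (PiE ?I (\<lambda>_. ?S))"
      by (simp_all add: cs)
    show "finite (PiE ?I (\<lambda>_. ?S))" by fact
    fix a assume a: "a \<in> PiE ?I (\<lambda>_. ?S)"
    define x where "x i = (if i \<le> n then a i else a 0)" for i
    have x: "range x \<subseteq> ?S" using a by (auto simp: x_def PiE_iff)
    have sing: "{a} \<in> sets (PiM ?I ?N)" using a by (simp add: cs)
    have cyl: "(\<lambda>x. restrict x ?I) -` {a} \<inter> space P = {\<pi>\<in>space P. \<forall>i\<le>n. \<pi> i = x i}"
              "(\<lambda>x. restrict x ?I) -` {a} \<inter> space Q = {\<pi>\<in>space Q. \<forall>i\<le>n. \<pi> i = x i}"
      using a by (auto simp: x_def fun_eq_iff PiE_iff extensional_def restrict_def)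
    have "measure P {\<pi>\<in>space P. \<forall>i\<le>n. \<pi> i = x i} = measure Q {\<pi>\<in>space Q. \<forall>i\<le>n. \<pi> i = x i}"
      using P Q x by (simp add: is_path_measure_def)
    then show "emeasure (distr P (PiM ?I ?N) (\<lambda>x. restrict x ?I)) {a} =
               emeasure (distr Q (PiM ?I ?N) (\<lambda>x. restrict x ?I)) {a}"
      by (simp add: emeasure_distr[OF meas(1) sing] emeasure_distr[OF meas(2) sing] cyl
          P.emeasure_eq_measure Q.emeasure_eq_measure)
  qed
  have "prod_emb UNIV ?N J (Pi\<^sub>E J A) = prod_emb UNIV ?N ?I (prod_emb ?I ?N J (Pi\<^sub>E J A))"
    using n by (simp add: prod_emb_trans)
  also have "\<dots> = (\<lambda>x. restrict x ?I) -` prod_emb ?I ?N J (Pi\<^sub>E J A) \<inter> space (PiM UNIV ?N)"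
    by (auto simp: prod_emb_def space_PiM)
  finally have 1: "prod_emb UNIV ?N J (Pi\<^sub>E J A) =
    (\<lambda>x. restrict x ?I) -` prod_emb ?I ?N J (Pi\<^sub>E J A) \<inter> space (PiM UNIV ?N)" .
  have 2: "prod_emb ?I ?N J (Pi\<^sub>E J A) \<in> sets (PiM ?I ?N)"
    using n A J by (intro measurable_prod_emb sets_PiM_I_finite) auto
  show "emeasure P (prod_emb UNIV ?N J (Pi\<^sub>E J A)) = emeasure Q (prod_emb UNIV ?N J (Pi\<^sub>E J A))"
    using emeasure_distr[OF meas(1) 2] emeasure_distr[OF meas(2) 2]
    by (simp add: 1 eq spP space_PiM)
qed

lemma ex_path_measure:
  assumes M: "markov_chain M" and s: "s \<in> states M"
  shows "\<exists>P. is_path_measure M s P"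
proof -
  let ?S = "states M" let ?N = "\<lambda>_::nat. count_space (states M)"
  have fin: "finite ?S" using M by (simp add: markov_chain_def)
  define t :: "nat \<Rightarrow> (nat \<Rightarrow> 'a) \<Rightarrow> 'a \<Rightarrow> real"
    where "t n x u = (if n = 0 then (if u = s then 1 else 0) else tprob M (x (n - 1)) u)" for n x u
  define K where "K n x = point_measure ?S (\<lambda>u. ennreal (t n x u))" for n x
  have cs: "PiM {0..<n} ?N = count_space (PiE {0..<n} (\<lambda>_. ?S))" for n
    using fin by (intro count_space_PiM_finite) (auto intro: countable_finite)
  have t_nonneg: "t n x u \<ge> 0" if "x \<in> space (PiM {0..<n} ?N)" "u \<in> ?S" for n x u
    using M that by (auto simp: t_def markov_chain_def space_PiM PiE_iff)
  have t_sum: "(\<Sum>u\<in>?S. t n x u) = 1" if "x \<in> space (PiM {0..<n} ?N)" for n x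
    using M that s fin by (cases "n = 0") (auto simp: t_def markov_chain_def space_PiM PiE_iff)
  have pK: "prob_space (K n x)" if "x \<in> space (PiM {0..<n} ?N)" for n x
    unfolding K_def using fin t_nonneg[OF that] t_sum[OF that]
    by (intro prob_space_point_measure) (auto simp: sum_ennreal)
  interpret IT: Ionescu_Tulcea K ?N
  proof (rule Ionescu_Tulcea.intro)
    fix i
    show "K i \<in> measurable (PiM {0..<i} ?N) (subprob_algebra (?N i))"
    proof -
      have "K i x \<in> space (subprob_algebra (?N i))" if "x \<in> space (PiM {0..<i} ?N)" for x
        using prob_space_imp_subprob_space[OF pK[OF that]]
        by (simp add: space_subprob_algebra) (simp add: K_def sets_point_measure)
      then show ?thesis unfolding cs by auto
    qed
  qed (rule pK)
  have K_single: "emeasure (K n x) {u} = ennreal (t n x u)" if "u \<in> ?S" for n x u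
    using that fin by (simp add: K_def emeasure_point_measure_finite)
  let ?w = "\<lambda>_::nat. undefined::'a"
  have w: "?w \<in> space (PiM {0..<0} ?N)" by (simp add: space_PiM)
  have C: "emeasure (IT.C 0 n ?w) {restrict x {0..<n}} = (\<Prod>i<n. ennreal (t i x (x i)))"
    if x: "range x \<subseteq> ?S" for n x
  proof (induction n)
    case 0
    show ?case by (simp add: PiM_empty restrict_def)
  next
    case (Suc n)
    let ?x = "restrict x {0..<n}" and ?y = "restrict x {0..<Suc n}"
    have xs: "?x \<in> space (PiM {0..<n} ?N)" and ys: "{?y} \<in> sets (PiM {0..<Suc n} ?N)"
      using x by (auto simp: space_PiM cs)
    have spC: "space (IT.C 0 n ?w) = space (PiM {0..<n} ?N)" using IT.space_C[OF w, of n] by simp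
    have "emeasure (IT.C 0 (Suc n) ?w) {?y} = (\<integral>\<^sup>+z. emeasure (IT.eP n z) {?y} \<partial>IT.C 0 n ?w)"
    proof -
      have "IT.eP n \<in> measurable (IT.C 0 n ?w) (subprob_algebra (PiM {0..<Suc n} ?N))"
        using IT.measurable_eP[of n] IT.sets_C[OF w, of n] by (simp cong: measurable_cong_sets)
      moreover have "space (IT.C 0 n ?w) \<noteq> {}" using xs unfolding spC by blast
      ultimately show ?thesis using ys by (simp add: emeasure_bind)
    qed
    also have "\<dots> = (\<integral>\<^sup>+z. ennreal (t n x (x n)) * indicator {?x} z \<partial>IT.C 0 n ?w)"
    proof (rule nn_integral_cong)
      fix z assume "z \<in> space (IT.C 0 n ?w)"
      then have z: "z \<in> space (PiM {0..<n} ?N)" by (simp add: spC)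
      have e: "(\<lambda>u. z(n := u)) -` {?y} \<inter> ?S = (if z = ?x then {x n} else {})"
      proof -
        have zu: "z i = undefined" if "\<not> i < n" for i
          using z that by (auto simp: space_PiM PiE_iff extensional_def)
        have *: "z(n := u) = ?y \<longleftrightarrow> z = ?x \<and> u = x n" for u
        proof
          assume eq: "z(n := u) = ?y"
          have "z i = ?x i" for i using fun_cong[OF eq, of i] zu[of i] by (cases "i < n") auto
          then show "z = ?x \<and> u = x n" using fun_cong[OF eq, of n] by auto
        qed (auto simp: fun_eq_iff)
        show ?thesis unfolding vimage_def singleton_iff * using x by auto
      qed
      have "t n ?x (x n) = t n x (x n)" by (simp add: t_def)
      then show "emeasure (IT.eP n z) {?y} = ennreal (t n x (x n)) * indicator {?x} z"
        using x K_single[of "x n" n ?x] by (subst IT.emeasure_eP[OF z ys]) (simp add: e image_subset_iff)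
    qed
    also have "\<dots> = ennreal (t n x (x n)) * emeasure (IT.C 0 n ?w) {?x}"
      using xs IT.sets_C[OF w, of n] by (intro nn_integral_cmult_indicator) (simp add: cs)
    finally show ?case by (simp only: Suc prod.lessThan_Suc mult.commute)
  qed
  let ?P = "IT.PF.lim"
  have cyl: "emeasure ?P {\<pi>\<in>space ?P. \<forall>i\<le>n. \<pi> i = x i} = (\<Prod>i<Suc n. ennreal (t i x (x i)))"
    if x: "range x \<subseteq> ?S" for n x
  proof -
    let ?y = "restrict x {0..<Suc n}"
    have ys: "{?y} \<in> sets (PiM {0..<Suc n} ?N)" using x by (auto simp: cs)
    have "{\<pi>\<in>space ?P. \<forall>i\<le>n. \<pi> i = x i} = IT.PF.emb UNIV {0..<Suc n} {?y}"
      by (auto simp: prod_emb_def space_PiM fun_eq_iff less_Suc_eq_le restrict_def) metis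
    also have "emeasure ?P \<dots> = IT.CI {0..<Suc n} {?y}"
      using ys by (intro IT.lim) auto
    also have "\<dots> = IT.C 0 (Suc n) ?w (IT.PF.emb {0..<Suc n} {0..<Suc n} {?y})"
      using ys by (intro IT.emeasure_CI) auto
    also have "IT.PF.emb {0..<Suc n} {0..<Suc n} {?y} = {?y}"
      using sets.sets_into_space[OF ys] by (intro prod_emb_id) (simp add: space_PiM)
    finally show ?thesis using C[OF x, of "Suc n"] by simp
  qed
  have "is_path_measure M s ?P"
    unfolding is_path_measure_def
  proof (intro conjI allI impI)
    show "prob_space ?P"
    proof
      have "emeasure ?P (IT.PF.emb UNIV {} {\<lambda>_. undefined}) = emeasure (IT.CI {}) {\<lambda>_. undefined}"
        by (intro IT.lim) (auto simp: PiM_empty)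
      also have "IT.PF.emb UNIV {} {\<lambda>_. undefined} = space ?P"
        by (auto simp: prod_emb_def space_PiM restrict_def)
      also have "emeasure (IT.CI {}) {\<lambda>_. undefined} = 1"
        using prob_space.emeasure_space_1[OF IT.PF.prob_space_P[of "{}"]]
        by (simp add: IT.PF.space_P space_PiM)
      finally show "emeasure ?P (space ?P) = 1" .
    qed
    show "sets ?P = sets (PiM UNIV ?N)" by simp
    fix n x assume x: "range (x :: nat \<Rightarrow> 'a) \<subseteq> ?S"
    have nn: "0 \<le> t i x (x i)" for i
      using M x by (auto simp: t_def markov_chain_def image_subset_iff)
    have "(\<Prod>i<Suc n. t i x (x i)) = (if x 0 = s then \<Prod>i<n. tprob M (x i) (x (Suc i)) else 0)"
      by (subst prod.lessThan_Suc_shift) (simp add: t_def)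
    moreover have "measure ?P {\<pi>\<in>space ?P. \<forall>i\<le>n. \<pi> i = x i} = (\<Prod>i<Suc n. t i x (x i))"
      unfolding measure_def cyl[OF x] using nn
      by (subst prod_ennreal) (simp_all add: prod_nonneg del: prod.lessThan_Suc)
    ultimately show "measure ?P {\<pi>\<in>space ?P. \<forall>i\<le>n. \<pi> i = x i} =
      (if x 0 = s then \<Prod>i<n. tprob M (x i) (x (Suc i)) else 0)" by simp
  qed
  then show ?thesis ..
qed

lemma ex1_path_measure:
  assumes "markov_chain M" "s \<in> states M"
  shows "\<exists>!P. is_path_measure M s P"
  using assms ex_path_measure path_measure_unique by (metis markov_chain_def)

lemma is_path_measure_path_measure:
  assumes "markov_chain M" "s \<in> states M"
  shows "is_path_measure M s (path_measure M s)"
  unfolding path_measure_def using ex1_path_measure[OF assms] by (rule theI')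


section \<open>Thresholds\<close>

datatype cmp = Greater | GreaterEq

fun cmp_holds :: "cmp \<Rightarrow> real \<Rightarrow> real \<Rightarrow> bool" where
  "cmp_holds Greater x p \<longleftrightarrow> x > p"
| "cmp_holds GreaterEq x p \<longleftrightarrow> x \<ge> p"

definition next_sem :: "('s, 'a) mchain \<Rightarrow> cmp \<Rightarrow> real \<Rightarrow> 's set \<Rightarrow> 's set" where
  "next_sem M c p A = {s\<in>states M. cmp_holds c (\<Sum>t\<in>A. tprob M s t) p}"


section \<open>The probabilistic mu-calculus\<close>

datatype ('a, 'z) pmu =
    MTrue | MFalse | MAtom 'a | MNegAtom 'a | MVar 'z
  | MNext cmp real "('a, 'z) pmu"
  | MAnd "('a, 'z) pmu" "('a, 'z) pmu"
  | MOr "('a, 'z) pmu" "('a, 'z) pmu"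
  | Mu 'z "('a, 'z) pmu"
  | Nu 'z "('a, 'z) pmu"

text \<open>
  Intersecting the value of a variable with the state set changes nothing for assignments into
  subsets of the state set. It makes every denotation a subset of the state set, so that
  the fixpoints taken in the lattice of all sets over the state type are the fixpoints in the
  powerset of the state set, as confirmed by \<open>pmu_sem_Mu_Least\<close> and \<open>pmu_sem_Nu_Greatest\<close>.
\<close>

primrec pmu_sem :: "('s, 'a) mchain \<Rightarrow> ('z \<Rightarrow> 's set) \<Rightarrow> ('a, 'z) pmu \<Rightarrow> 's set" where
  "pmu_sem M e MTrue = states M"
| "pmu_sem M e MFalse = {}"
| "pmu_sem M e (MAtom a) = {s\<in>states M. a \<in> label M s}"
| "pmu_sem M e (MNegAtom a) = {s\<in>states M. a \<notin> label M s}"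
| "pmu_sem M e (MVar Z) = e Z \<inter> states M"
| "pmu_sem M e (MNext c p f) = next_sem M c p (pmu_sem M e f)"
| "pmu_sem M e (MAnd f1 f2) = pmu_sem M e f1 \<inter> pmu_sem M e f2"
| "pmu_sem M e (MOr f1 f2) = pmu_sem M e f1 \<union> pmu_sem M e f2"
| "pmu_sem M e (Mu Z f) = lfp (\<lambda>X. pmu_sem M (e(Z := X)) f)"
| "pmu_sem M e (Nu Z f) = gfp (\<lambda>X. pmu_sem M (e(Z := X)) f)"

primrec pmu_wf :: "('a, 'z) pmu \<Rightarrow> bool" where
  "pmu_wf MTrue \<longleftrightarrow> True"
| "pmu_wf MFalse \<longleftrightarrow> True"
| "pmu_wf (MAtom a) \<longleftrightarrow> True"
| "pmu_wf (MNegAtom a) \<longleftrightarrow> True"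
| "pmu_wf (MVar Z) \<longleftrightarrow> True"
| "pmu_wf (MNext c p f) \<longleftrightarrow> p \<in> {0..1} \<and> pmu_wf f"
| "pmu_wf (MAnd f1 f2) \<longleftrightarrow> pmu_wf f1 \<and> pmu_wf f2"
| "pmu_wf (MOr f1 f2) \<longleftrightarrow> pmu_wf f1 \<and> pmu_wf f2"
| "pmu_wf (Mu Z f) \<longleftrightarrow> pmu_wf f"
| "pmu_wf (Nu Z f) \<longleftrightarrow> pmu_wf f"

primrec free_vars :: "('a, 'z) pmu \<Rightarrow> 'z set" where
  "free_vars MTrue = {}"
| "free_vars MFalse = {}"
| "free_vars (MAtom a) = {}"
| "free_vars (MNegAtom a) = {}"
| "free_vars (MVar Z) = {Z}"
| "free_vars (MNext c p f) = free_vars f"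
| "free_vars (MAnd f1 f2) = free_vars f1 \<union> free_vars f2"
| "free_vars (MOr f1 f2) = free_vars f1 \<union> free_vars f2"
| "free_vars (Mu Z f) = free_vars f - {Z}"
| "free_vars (Nu Z f) = free_vars f - {Z}"

text \<open>For closed formulas; the choice of assignment is immaterial by \<open>pmu_sem_closed\<close>.\<close>

definition pmu_sem_closed :: "('s, 'a) mchain \<Rightarrow> ('a, 'z) pmu \<Rightarrow> 's set" where
  "pmu_sem_closed M f = pmu_sem M (\<lambda>_. {}) f"

lemma pmu_sem_cong:
  "(\<And>Z. Z \<in> free_vars f \<Longrightarrow> e Z = e' Z) \<Longrightarrow> pmu_sem M e f = pmu_sem M e' f"
proof (induction f arbitrary: e e')
  case (Mu Z f)
  have "pmu_sem M (e(Z := X)) f = pmu_sem M (e'(Z := X)) f" for X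
    by (rule Mu.IH) (use Mu.prems in auto)
  then show ?case by simp
next
  case (Nu Z f)
  have "pmu_sem M (e(Z := X)) f = pmu_sem M (e'(Z := X)) f" for X
    by (rule Nu.IH) (use Nu.prems in auto)
  then show ?case by simp
next
  case (MNext c p f)
  have "pmu_sem M e f = pmu_sem M e' f" by (rule MNext.IH) (use MNext.prems in simp)
  then show ?case by simp
next
  case (MAnd f1 f2)
  have "pmu_sem M e f1 = pmu_sem M e' f1" by (rule MAnd.IH(1)) (use MAnd.prems in simp)
  moreover have "pmu_sem M e f2 = pmu_sem M e' f2" by (rule MAnd.IH(2)) (use MAnd.prems in simp)
  ultimately show ?case by simp
next
  case (MOr f1 f2)
  have "pmu_sem M e f1 = pmu_sem M e' f1" by (rule MOr.IH(1)) (use MOr.prems in simp)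
  moreover have "pmu_sem M e f2 = pmu_sem M e' f2" by (rule MOr.IH(2)) (use MOr.prems in simp)
  ultimately show ?case by simp
qed auto

lemma pmu_sem_closed:
  "free_vars f = {} \<Longrightarrow> pmu_sem M e f = pmu_sem_closed M f"
  unfolding pmu_sem_closed_def by (rule pmu_sem_cong) simp

lemma pmu_sem_mono:
  assumes M: "markov_chain M"
  shows "(\<And>Z. e Z \<subseteq> e' Z) \<Longrightarrow> pmu_sem M e f \<subseteq> pmu_sem M e' f \<and> pmu_sem M e' f \<subseteq> states M"
proof (induction f arbitrary: e e')
  case (MNext c p f)
  have IH: "pmu_sem M e f \<subseteq> pmu_sem M e' f" "pmu_sem M e' f \<subseteq> states M"
    using MNext.IH[of e e'] MNext.prems by auto
  have "(\<Sum>t\<in>pmu_sem M e f. tprob M s t) \<le> (\<Sum>t\<in>pmu_sem M e' f. tprob M s t)" if "s \<in> states M" for s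
    using M IH that by (intro sum_mono2) (auto simp: markov_chain_def intro: finite_subset)
  then show ?case by (cases c) (auto simp: next_sem_def intro: less_le_trans order_trans)
next
  case (MAnd f1 f2)
  have "pmu_sem M e f1 \<subseteq> pmu_sem M e' f1 \<and> pmu_sem M e' f1 \<subseteq> states M"
    by (rule MAnd.IH(1)) (rule MAnd.prems)
  moreover have "pmu_sem M e f2 \<subseteq> pmu_sem M e' f2 \<and> pmu_sem M e' f2 \<subseteq> states M"
    by (rule MAnd.IH(2)) (rule MAnd.prems)
  ultimately show ?case by auto
next
  case (MOr f1 f2)
  have "pmu_sem M e f1 \<subseteq> pmu_sem M e' f1 \<and> pmu_sem M e' f1 \<subseteq> states M"
    by (rule MOr.IH(1)) (rule MOr.prems)
  moreover have "pmu_sem M e f2 \<subseteq> pmu_sem M e' f2 \<and> pmu_sem M e' f2 \<subseteq> states M"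
    by (rule MOr.IH(2)) (rule MOr.prems)
  ultimately show ?case by auto
next
  case (Mu Z f)
  have *: "pmu_sem M (e(Z := X)) f \<subseteq> pmu_sem M (e'(Z := X)) f \<and> pmu_sem M (e'(Z := X)) f \<subseteq> states M"
    for X by (rule Mu.IH) (use Mu.prems in simp)
  show ?case unfolding pmu_sem.simps
    using * by (intro conjI lfp_mono lfp_lowerbound) blast+
next
  case (Nu Z f)
  have *: "pmu_sem M (e(Z := X)) f \<subseteq> pmu_sem M (e'(Z := X)) f \<and> pmu_sem M (e'(Z := X)) f \<subseteq> states M"
    for X by (rule Nu.IH) (use Nu.prems in simp)
  show ?case unfolding pmu_sem.simps
    using * by (intro conjI gfp_mono gfp_least) blast+
qed auto


lemma pmu_sem_fixpoint_mono:
  assumes "markov_chain M"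
  shows "mono (\<lambda>X. pmu_sem M (e(Z := X)) f)"
proof (rule monoI)
  fix X Y :: "'a set" assume "X \<subseteq> Y"
  then have "(e(Z := X)) V \<subseteq> (e(Z := Y)) V" for V by simp
  then show "pmu_sem M (e(Z := X)) f \<subseteq> pmu_sem M (e(Z := Y)) f"
    using pmu_sem_mono[OF assms, of "e(Z := X)" "e(Z := Y)" f] by blast
qed

lemma pmu_sem_subset: "markov_chain M \<Longrightarrow> pmu_sem M e f \<subseteq> states M"
  using pmu_sem_mono[of M e e f] by blast

lemma pmu_sem_Mu_Least:
  assumes M: "markov_chain M"
  shows "pmu_sem M e (Mu Z f) = (LEAST X. X \<subseteq> states M \<and> pmu_sem M (e(Z := X)) f = X)"
proof (rule Least_equality[symmetric])
  show "pmu_sem M e (Mu Z f) \<subseteq> states M \<and>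
        pmu_sem M (e(Z := pmu_sem M e (Mu Z f))) f = pmu_sem M e (Mu Z f)"
    using lfp_unfold[OF pmu_sem_fixpoint_mono[OF M, of e Z f]] pmu_sem_subset[OF M, of e "Mu Z f"]
    by simp
next
  fix Y assume "Y \<subseteq> states M \<and> pmu_sem M (e(Z := Y)) f = Y"
  then show "pmu_sem M e (Mu Z f) \<subseteq> Y" by (simp add: lfp_lowerbound)
qed

lemma pmu_sem_Nu_Greatest:
  assumes M: "markov_chain M"
  shows "pmu_sem M e (Nu Z f) = (GREATEST X. X \<subseteq> states M \<and> pmu_sem M (e(Z := X)) f = X)"
proof (rule Greatest_equality[symmetric])
  show "pmu_sem M e (Nu Z f) \<subseteq> states M \<and>
        pmu_sem M (e(Z := pmu_sem M e (Nu Z f))) f = pmu_sem M e (Nu Z f)"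
    using gfp_unfold[OF pmu_sem_fixpoint_mono[OF M, of e Z f]] pmu_sem_subset[OF M, of e "Nu Z f"]
    by simp
next
  fix Y assume "Y \<subseteq> states M \<and> pmu_sem M (e(Z := Y)) f = Y"
  then show "Y \<subseteq> pmu_sem M e (Nu Z f)" by (simp add: gfp_upperbound)
qed


section \<open>PCTL\<close>

datatype 'a pctl =
    PTrue | PFalse | PAtom 'a | PNegAtom 'a
  | PNext cmp real "'a pctl"
  | PAnd "'a pctl" "'a pctl"
  | POr "'a pctl" "'a pctl"
  | PUntil cmp real "'a pctl" "'a pctl"
  | PRelease cmp real "'a pctl" "'a pctl"

primrec pctl_wf :: "'a pctl \<Rightarrow> bool" where
  "pctl_wf PTrue \<longleftrightarrow> True"
| "pctl_wf PFalse \<longleftrightarrow> True"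
| "pctl_wf (PAtom a) \<longleftrightarrow> True"
| "pctl_wf (PNegAtom a) \<longleftrightarrow> True"
| "pctl_wf (PNext c p g) \<longleftrightarrow> p \<in> {0..1} \<and> pctl_wf g"
| "pctl_wf (PAnd g1 g2) \<longleftrightarrow> pctl_wf g1 \<and> pctl_wf g2"
| "pctl_wf (POr g1 g2) \<longleftrightarrow> pctl_wf g1 \<and> pctl_wf g2"
| "pctl_wf (PUntil c p g1 g2) \<longleftrightarrow> p \<in> {0..1} \<and> pctl_wf g1 \<and> pctl_wf g2"
| "pctl_wf (PRelease c p g1 g2) \<longleftrightarrow> p \<in> {0..1} \<and> pctl_wf g1 \<and> pctl_wf g2"

definition sat_until :: "'s set \<Rightarrow> 's set \<Rightarrow> (nat \<Rightarrow> 's) \<Rightarrow> bool" where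
  "sat_until A B \<pi> \<longleftrightarrow> (\<exists>i. \<pi> i \<in> B \<and> (\<forall>j<i. \<pi> j \<in> A))"

definition sat_release :: "'s set \<Rightarrow> 's set \<Rightarrow> (nat \<Rightarrow> 's) \<Rightarrow> bool" where
  "sat_release A B \<pi> \<longleftrightarrow> sat_until B (A \<inter> B) \<pi> \<or> (\<forall>j. \<pi> j \<in> B)"

primrec pctl_sem :: "('s, 'a) mchain \<Rightarrow> 'a pctl \<Rightarrow> 's set" where
  "pctl_sem M PTrue = states M"
| "pctl_sem M PFalse = {}"
| "pctl_sem M (PAtom a) = {s\<in>states M. a \<in> label M s}"
| "pctl_sem M (PNegAtom a) = {s\<in>states M. a \<notin> label M s}"
| "pctl_sem M (PNext c p g) = next_sem M c p (pctl_sem M g)"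
| "pctl_sem M (PAnd g1 g2) = pctl_sem M g1 \<inter> pctl_sem M g2"
| "pctl_sem M (POr g1 g2) = pctl_sem M g1 \<union> pctl_sem M g2"
| "pctl_sem M (PUntil c p g1 g2) =
     {s\<in>states M. cmp_holds c (Pr M s (sat_until (pctl_sem M g1) (pctl_sem M g2))) p}"
| "pctl_sem M (PRelease c p g1 g2) =
     {s\<in>states M. cmp_holds c (Pr M s (sat_release (pctl_sem M g1) (pctl_sem M g2))) p}"

end

(*
  On the states 0, ..., n let every state i move with probability 1/2 to i - 1 (0 and n to
  themselves) and otherwise jump according to a fixed distribution charging all states; a
  holds except at 0. The nu-formula holds at n only. A PCTL formula, however, does not
  distinguish n from n - 1 when n is large: until probabilities at high states approach the
  average R of the probabilities under the jump distribution, which is their value at n. A jump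
  distribution with rapidly decreasing weights keeps R close to 0 or 1, hence away
  from every threshold strictly between 0 and 1, and since every state reaches every state
  in one step, the thresholds 0 and 1 do not separate high states either.
*)
theory Submission
  imports Defs
begin

section \<open>Path measures of Markov chains\<close>

abbreviation path_space :: "('s, 'a) mchain \<Rightarrow> (nat \<Rightarrow> 's) measure" where
  "path_space M \<equiv> \<Pi>\<^sub>M i\<in>UNIV. count_space (states M)"

lemma
  assumes "markov_chain M" "s \<in> states M"
  shows prob_space_path_measure: "prob_space (path_measure M s)"
    and sets_path_measure: "sets (path_measure M s) = sets (path_space M)"
    and space_path_measure: "space (path_measure M s) = UNIV \<rightarrow>\<^sub>E states M"
proof -
  show "prob_space (path_measure M s)" and *: "sets (path_measure M s) = sets (path_space M)"
    using is_path_measure_path_measure[OF assms] by (auto simp: is_path_measure_def)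
  show "space (path_measure M s) = UNIV \<rightarrow>\<^sub>E states M"
    using sets_eq_imp_space_eq[OF *] by (simp add: space_PiM)
qed

lemma pred_path_component [measurable]:
  "Measurable.pred (path_space M) (\<lambda>\<pi>. Q (\<pi> i))"
proof -
  have "Measurable.pred (count_space (states M)) Q" by simp
  moreover have "(\<lambda>\<pi>. \<pi> i) \<in> path_space M \<rightarrow>\<^sub>M count_space (states M)"
    by (rule measurable_component_singleton) simp
  ultimately show ?thesis by (rule measurable_compose_rev)
qed

lemma measurable_case_nat_path:
  assumes "s \<in> states M"
  shows "case_nat s \<in> path_space M \<rightarrow>\<^sub>M path_space M"
proof -
  have "(\<lambda>\<pi>. s) \<in> path_space M \<rightarrow>\<^sub>M count_space (states M)" using assms by simp
  from measurable_case_nat'[OF this measurable_ident] show ?thesis by simp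
qed

lemma path_measure_cylinder:
  assumes "markov_chain M" "s \<in> states M" "range x \<subseteq> states M"
  shows "measure (path_measure M s) {\<pi>\<in>UNIV \<rightarrow>\<^sub>E states M. \<forall>i\<le>n. \<pi> i = x i} =
    (if x 0 = s then \<Prod>i<n. tprob M (x i) (x (Suc i)) else 0)"
  using is_path_measure_path_measure[OF assms(1,2)] assms(3)
  unfolding is_path_measure_def space_path_measure[OF assms(1,2)] by blast

lemma path_measure_initial:
  assumes "markov_chain M" "s \<in> states M"
  shows "AE \<pi> in path_measure M s. \<pi> 0 = s"
proof -
  interpret prob_space "path_measure M s" by (rule prob_space_path_measure[OF assms])
  have "prob {\<pi>\<in>space (path_measure M s). \<forall>i\<le>0. \<pi> i = s} = 1"
    using path_measure_cylinder[OF assms, of "\<lambda>_. s" 0] assms(2)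
    by (simp add: space_path_measure[OF assms])
  then show ?thesis
    by (subst (asm) prob_Collect_eq_1) (simp_all add: pred_path_component measurable_cong_sets[OF sets_path_measure[OF assms] refl] flip: pred_def)
qed

section \<open>First-step decomposition of the path measure\<close>

text \<open>
  The right-hand side defines a measure with the cylinder probabilities of the left-hand
  side, so uniqueness of the path measure applies.
\<close>

lemma emeasure_path_measure_step:
  assumes M: "markov_chain M" and s: "s \<in> states M" and X: "X \<in> sets (path_space M)"
  shows "emeasure (path_measure M s) X =
    (\<Sum>t\<in>states M. ennreal (tprob M s t) * emeasure (path_measure M t) (case_nat s -` X \<inter> (UNIV \<rightarrow>\<^sub>E states M)))"
proof -
  let ?S = "states M" let ?N = "path_space M"
  \<comment> \<open>\<open>Q\<close> draws a successor \<open>t\<close> from the transition row of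
    \<open>s\<close> (\<open>K\<close>), samples a path from \<open>t\<close>, and prepends
    \<open>s\<close> (\<open>D\<close>).\<close>
  define D where "D t = distr (path_measure M t) ?N (case_nat s)" for t
  define K where "K = point_measure ?S (\<lambda>t. ennreal (tprob M s t))"
  define Q where "Q = K \<bind> D"
  have fin: "finite ?S" and nonneg: "\<And>t. t \<in> ?S \<Longrightarrow> 0 \<le> tprob M s t" and
    total: "(\<Sum>t\<in>?S. tprob M s t) = 1"
    using M s by (auto simp: markov_chain_def)
  have cn: "case_nat s \<in> path_measure M t \<rightarrow>\<^sub>M ?N" if "t \<in> ?S" for t
    using measurable_case_nat_path[OF s] by (simp add: sets_path_measure[OF M that] cong: measurable_cong_sets)
  have pD: "prob_space (D t)" if "t \<in> ?S" for t
    unfolding D_def using prob_space.prob_space_distr[OF prob_space_path_measure[OF M that] cn[OF that]] .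
  have eD: "emeasure (D t) X = emeasure (path_measure M t) (case_nat s -` X \<inter> (UNIV \<rightarrow>\<^sub>E ?S))"
    if "t \<in> ?S" "X \<in> sets ?N" for t X
    unfolding D_def by (simp add: emeasure_distr[OF cn[OF that(1)] that(2)] space_path_measure[OF M that(1)])
  have "D \<in> count_space ?S \<rightarrow>\<^sub>M subprob_algebra ?N"
    using pD by (auto simp: space_subprob_algebra prob_space_imp_subprob_space D_def)
  then have mD: "D \<in> K \<rightarrow>\<^sub>M subprob_algebra ?N"
    by (simp add: K_def cong: measurable_cong_sets)
  have ne: "space K \<noteq> {}" using s by (auto simp: K_def space_point_measure)
  have sQ: "sets Q = sets ?N" unfolding Q_def by (rule sets_bind[OF _ ne]) (simp add: D_def)
  have spQ: "space Q = UNIV \<rightarrow>\<^sub>E ?S" using sets_eq_imp_space_eq[OF sQ] by (simp add: space_PiM)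
  have eQ: "emeasure Q X = (\<Sum>t\<in>?S. ennreal (tprob M s t) *
      emeasure (path_measure M t) (case_nat s -` X \<inter> (UNIV \<rightarrow>\<^sub>E ?S)))"
    if "X \<in> sets ?N" for X
  proof -
    have "emeasure Q X = (\<integral>\<^sup>+t. emeasure (D t) X \<partial>K)"
      unfolding Q_def by (rule emeasure_bind[OF ne mD that])
    also have "\<dots> = (\<Sum>t\<in>?S. emeasure (D t) X * ennreal (tprob M s t))"
      unfolding K_def using fin by (simp add: nn_integral_point_measure_finite mult.commute)
    finally show ?thesis using that by (simp add: eD mult.commute)
  qed
  have "is_path_measure M s Q"
    unfolding is_path_measure_def
  proof (intro conjI allI impI)
    have full: "case_nat s -` (UNIV \<rightarrow>\<^sub>E ?S) \<inter> (UNIV \<rightarrow>\<^sub>E ?S) = (UNIV \<rightarrow>\<^sub>E ?S)"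
      using s by (auto simp: PiE_iff split: nat.split)
    have one: "emeasure (path_measure M t) (UNIV \<rightarrow>\<^sub>E ?S) = 1" if "t \<in> ?S" for t
      using prob_space.emeasure_space_1[OF prob_space_path_measure[OF M that]]
      by (simp add: space_path_measure[OF M that])
    have "(UNIV \<rightarrow>\<^sub>E ?S) \<in> sets ?N" using sets.top[of ?N] by (simp add: space_PiM)
    with one show "prob_space Q"
      by (intro prob_spaceI) (simp add: spQ eQ full nonneg total)
    show "sets Q = sets ?N" by (rule sQ)
    fix n x assume x: "range (x :: nat \<Rightarrow> _) \<subseteq> ?S"
    let ?C = "{\<pi>\<in>space Q. \<forall>i\<le>n. \<pi> i = x i}"
    have Cs: "?C \<in> sets ?N"
      unfolding spQ space_PiM[symmetric, of UNIV "\<lambda>_. count_space ?S", simplified] by measurable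
    let ?Y = "\<lambda>t. emeasure (path_measure M t) (case_nat s -` ?C \<inter> (UNIV \<rightarrow>\<^sub>E ?S))"
    have "emeasure Q ?C = ennreal (if x 0 = s then \<Prod>i<n. tprob M (x i) (x (Suc i)) else 0)"
    proof (cases "x 0 = s")
      case False
      then have empty: "case_nat s -` ?C = {}" by auto
      show ?thesis unfolding eQ[OF Cs] empty using False by simp
    next
      case True
      show ?thesis
      \<comment> \<open>For \<open>n = 0\<close> the cylinder constrains only the prepended state,
        so its mass is the row sum 1. Otherwise it becomes the cylinder of the shifted sequence up
        to \<open>n - 1\<close>, and only the summand \<open>t = x 1\<close> survives.\<close>
      proof (cases n)
        case 0
        have "?C = {\<pi>\<in>UNIV \<rightarrow>\<^sub>E ?S. \<pi> 0 = s}" using True 0 by (auto simp: spQ)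
        then have all: "case_nat s -` ?C \<inter> (UNIV \<rightarrow>\<^sub>E ?S) = (UNIV \<rightarrow>\<^sub>E ?S)"
          using s by (auto simp: PiE_iff split: nat.split)
        show ?thesis
          unfolding eQ[OF Cs] all using True 0 by (simp add: one nonneg total)
      next
        case (Suc m)
        have eq: "case_nat s -` ?C \<inter> (UNIV \<rightarrow>\<^sub>E ?S) =
            {\<pi>\<in>UNIV \<rightarrow>\<^sub>E ?S. \<forall>i\<le>m. \<pi> i = x (Suc i)}"
        proof -
          have "(\<forall>i\<le>n. case_nat s \<pi> i = x i) \<longleftrightarrow> (\<forall>i\<le>m. \<pi> i = x (Suc i))" for \<pi>
            using True unfolding Suc less_Suc_eq_le[symmetric] by (subst All_less_Suc2) simp
          then show ?thesis using s by (auto simp: spQ PiE_iff split: nat.split)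
        qed
        have Y: "?Y t = ennreal (if x 1 = t then \<Prod>i<m. tprob M (x (Suc i)) (x (Suc (Suc i))) else 0)"
          if t: "t \<in> ?S" for t
        proof -
          interpret prob_space "path_measure M t" by (rule prob_space_path_measure[OF M t])
          have "range (\<lambda>i. x (Suc i)) \<subseteq> ?S" using x by auto
          from path_measure_cylinder[OF M t this, of m] show ?thesis
            unfolding eq by (simp add: emeasure_eq_measure)
        qed
        let ?p = "\<Prod>i<m. tprob M (x (Suc i)) (x (Suc (Suc i)))"
        have x1: "x 1 \<in> ?S" using x by blast
        have "emeasure Q ?C = (\<Sum>t\<in>?S. ennreal (tprob M s t) * ennreal (if x 1 = t then ?p else 0))"
          unfolding eQ[OF Cs] by (intro sum.cong refl) (simp only: Y)
        also have "\<dots> = (\<Sum>t\<in>?S. if x 1 = t then ennreal (tprob M s t) * ennreal ?p else 0)"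
          by (intro sum.cong refl) simp
        also have "\<dots> = ennreal (tprob M s (x 1)) * ennreal ?p"
          using fin x1 by simp
        also have "\<dots> = ennreal (tprob M s (x 1) * ?p)"
          by (rule ennreal_mult'[symmetric]) (rule nonneg[OF x1])
        also have "tprob M s (x 1) * ?p = (\<Prod>i<n. tprob M (x i) (x (Suc i)))"
          unfolding Suc using True by (subst prod.lessThan_Suc_shift) simp
        finally show ?thesis using True by simp
      qed
    qed
    moreover have "0 \<le> (\<Prod>i<n. tprob M (x i) (x (Suc i)))"
      using M x by (intro prod_nonneg) (auto simp: markov_chain_def image_subset_iff)
    ultimately show "measure Q ?C = (if x 0 = s then \<Prod>i<n. tprob M (x i) (x (Suc i)) else 0)"
      by (simp add: measure_def)
  qed
  then have "path_measure M s = Q"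
    using path_measure_unique[OF fin is_path_measure_path_measure[OF M s]] by blast
  then show ?thesis using eQ[OF X] by simp
qed

lemma measure_path_measure_step:
  assumes M: "markov_chain M" and s: "s \<in> states M" and Q: "Measurable.pred (path_space M) Q"
  shows "measure (path_measure M s) {\<pi>\<in>UNIV \<rightarrow>\<^sub>E states M. Q \<pi>} =
    (\<Sum>t\<in>states M. tprob M s t * measure (path_measure M t) {\<pi>\<in>UNIV \<rightarrow>\<^sub>E states M. Q (case_nat s \<pi>)})"
proof -
  have eq: "case_nat s -` {\<pi>\<in>UNIV \<rightarrow>\<^sub>E states M. Q \<pi>} \<inter> (UNIV \<rightarrow>\<^sub>E states M) =
      {\<pi>\<in>UNIV \<rightarrow>\<^sub>E states M. Q (case_nat s \<pi>)}"
    using s by (auto simp: PiE_iff split: nat.split)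
  have X: "{\<pi>\<in>UNIV \<rightarrow>\<^sub>E states M. Q \<pi>} \<in> sets (path_space M)"
    using Q by (simp add: pred_def space_PiM)
  have em: "emeasure (path_measure M t) Y = ennreal (measure (path_measure M t) Y)" if "t \<in> states M" for t Y
    using finite_measure.emeasure_eq_measure[OF prob_space.finite_measure[OF prob_space_path_measure[OF M that]]] .
  have nonneg: "0 \<le> tprob M s t" if "t \<in> states M" for t
    using M s that by (auto simp: markov_chain_def)
  have "ennreal (measure (path_measure M s) {\<pi>\<in>UNIV \<rightarrow>\<^sub>E states M. Q \<pi>}) =
    (\<Sum>t\<in>states M. ennreal (tprob M s t * measure (path_measure M t) {\<pi>\<in>UNIV \<rightarrow>\<^sub>E states M. Q (case_nat s \<pi>)}))"
    unfolding em[OF s, symmetric] emeasure_path_measure_step[OF M s X] eq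
    by (intro sum.cong refl) (simp add: em ennreal_mult' nonneg)
  also have "\<dots> = ennreal (\<Sum>t\<in>states M. tprob M s t * measure (path_measure M t) {\<pi>\<in>UNIV \<rightarrow>\<^sub>E states M. Q (case_nat s \<pi>)})"
    by (intro sum_ennreal) (simp add: nonneg)
  finally show ?thesis
    by (subst (asm) ennreal_inj) (auto intro!: sum_nonneg simp: nonneg)
qed

section \<open>Almost sure paths and probabilities of path events\<close>

lemma pred_path_components:
  assumes fin: "finite (states M)"
  shows "Measurable.pred (path_space M) (\<lambda>\<pi>. Q (\<pi> i) (\<pi> j))"
proof -
  \<comment> \<open>Fixing the value at \<open>i\<close> leaves a condition on one component;
    finitely many values make the union measurable.\<close>
  have "{\<pi>\<in>space (path_space M). Q (\<pi> i) (\<pi> j)} =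
      (\<Union>t\<in>states M. {\<pi>\<in>space (path_space M). \<pi> i = t \<and> Q t (\<pi> j)})"
    by (auto simp: space_PiM)
  also have "\<dots> \<in> sets (path_space M)"
    using fin by (intro sets.finite_UN) auto
  finally show ?thesis by (simp add: pred_def)
qed

lemma pred_path_measure_iff:
  assumes "markov_chain M" "s \<in> states M"
  shows "Measurable.pred (path_measure M s) Q \<longleftrightarrow> Measurable.pred (path_space M) Q"
  by (simp add: measurable_cong_sets[OF sets_path_measure[OF assms] refl])

lemma measure_path_measure_eq_0_iff:
  assumes M: "markov_chain M" and s: "s \<in> states M" and Q: "Measurable.pred (path_space M) Q"
  shows "measure (path_measure M s) {\<pi>\<in>UNIV \<rightarrow>\<^sub>E states M. Q \<pi>} = 0 \<longleftrightarrow>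
    (AE \<pi> in path_measure M s. \<not> Q \<pi>)"
proof -
  interpret prob_space "path_measure M s" by (rule prob_space_path_measure[OF M s])
  show ?thesis
    using prob_Collect_eq_0[of Q] Q pred_path_measure_iff[OF M s, of Q]
    by (simp add: pred_def space_path_measure[OF M s])
qed

text \<open>This lets \<open>Pr\<close> ignore its restriction to paths. Prepending a state turns a
  zero-probability transition at \<open>Suc i\<close> into one at \<open>i\<close>, so induction on
  \<open>i\<close> over all start states leaves the first transition, where a successor of weight 0
  contributes nothing and any other one is almost surely the state actually entered.\<close>

lemma AE_path_measure_paths:
  assumes M: "markov_chain M" and s: "s \<in> states M"
  shows "AE \<pi> in path_measure M s. \<pi> \<in> paths M s"
proof -
  have fin: "finite (states M)" using M by (simp add: markov_chain_def)
  note pred = pred_path_components[OF fin, of "\<lambda>t u. \<not> tprob M t u > 0"]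
  have zero: "measure (path_measure M s) {\<pi>\<in>UNIV \<rightarrow>\<^sub>E states M. \<not> tprob M (\<pi> i) (\<pi> (Suc i)) > 0} = 0"
    if "s \<in> states M" for i s
    using that
  proof (induction i arbitrary: s)
    case 0
    have "tprob M s t * measure (path_measure M t) {\<pi>\<in>UNIV \<rightarrow>\<^sub>E states M. \<not> tprob M s (\<pi> 0) > 0} = 0"
      if t: "t \<in> states M" for t
    proof (cases "tprob M s t > 0")
      case True
      have "AE \<pi> in path_measure M t. \<not> \<not> tprob M s (\<pi> 0) > 0"
        using path_measure_initial[OF M t] True by auto
      then have "measure (path_measure M t) {\<pi>\<in>UNIV \<rightarrow>\<^sub>E states M. \<not> tprob M s (\<pi> 0) > 0} = 0"
        by (subst measure_path_measure_eq_0_iff[OF M t]) (simp_all add: pred_path_component)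
      then show ?thesis by simp
    next
      case False
      then show ?thesis using M 0 t by (auto simp: markov_chain_def not_less order_antisym)
    qed
    then show ?case
      unfolding measure_path_measure_step[OF M 0 pred] by (intro sum.neutral) simp
  next
    case (Suc i)
    show ?case
      unfolding measure_path_measure_step[OF M Suc.prems pred] using Suc.IH by simp
  qed
  have "AE \<pi> in path_measure M s. \<forall>i. tprob M (\<pi> i) (\<pi> (Suc i)) > 0"
    unfolding AE_all_countable
    using zero[OF s] measure_path_measure_eq_0_iff[OF M s pred] by simp
  with path_measure_initial[OF M s] AE_space[of "path_measure M s"] show ?thesis
    by eventually_elim (auto simp: paths_def space_path_measure[OF M s] PiE_iff)
qed

text \<open>Non-paths form a null set; dropping the restriction to paths makes the first-step
  decomposition applicable to \<open>Pr\<close>.\<close>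

lemma Pr_eq_measure:
  assumes M: "markov_chain M" and s: "s \<in> states M" and Q: "Measurable.pred (path_space M) Q"
  shows "Pr M s Q = measure (path_measure M s) {\<pi>\<in>UNIV \<rightarrow>\<^sub>E states M. Q \<pi>}"
proof -
  interpret prob_space "path_measure M s" by (rule prob_space_path_measure[OF M s])
  have fin: "finite (states M)" using M by (simp add: markov_chain_def)
  note [measurable] = Q pred_path_components[OF fin, of "\<lambda>t u. tprob M t u > 0"]
  have "{\<pi>\<in>paths M s. Q \<pi>} =
      {\<pi>\<in>space (path_space M). \<pi> 0 = s \<and> (\<forall>i. tprob M (\<pi> i) (\<pi> (Suc i)) > 0) \<and> Q \<pi>}"
    by (auto simp: paths_def space_PiM PiE_iff)
  also have "\<dots> \<in> sets (path_space M)" by measurable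
  finally have 1: "{\<pi>\<in>paths M s. Q \<pi>} \<in> events" by (simp add: sets_path_measure[OF M s])
  have 2: "{\<pi>\<in>UNIV \<rightarrow>\<^sub>E states M. Q \<pi>} \<in> events"
    using Q by (simp add: pred_def space_PiM sets_path_measure[OF M s])
  have "AE \<pi> in path_measure M s. \<pi> \<in> {\<pi>\<in>paths M s. Q \<pi>} \<longleftrightarrow> \<pi> \<in> {\<pi>\<in>UNIV \<rightarrow>\<^sub>E states M. Q \<pi>}"
    using AE_path_measure_paths[OF M s] by eventually_elim (auto simp: paths_def)
  then show ?thesis unfolding Pr_def by (rule finite_measure_eq_AE[OF _ 1 2])
qed

lemma Pr_bounds:
  assumes "markov_chain M" "s \<in> states M"
  shows "0 \<le> Pr M s Q" "Pr M s Q \<le> 1"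
  using prob_space.prob_le_1[OF prob_space_path_measure[OF assms]] by (simp_all add: Pr_def)

lemma Pr_AE_True:
  assumes M: "markov_chain M" and s: "s \<in> states M" and Q: "Measurable.pred (path_space M) Q"
    and "AE \<pi> in path_measure M s. Q \<pi>"
  shows "Pr M s Q = 1"
proof -
  interpret prob_space "path_measure M s" by (rule prob_space_path_measure[OF M s])
  show ?thesis
    unfolding Pr_eq_measure[OF M s Q] using assms(4) Q pred_path_measure_iff[OF M s, of Q]
    by (simp add: pred_def prob_Collect_eq_1 flip: space_path_measure[OF M s])
qed

lemma Pr_AE_False:
  assumes M: "markov_chain M" and s: "s \<in> states M" and Q: "Measurable.pred (path_space M) Q"
    and "AE \<pi> in path_measure M s. \<not> Q \<pi>"
  shows "Pr M s Q = 0"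
  unfolding Pr_eq_measure[OF M s Q] using measure_path_measure_eq_0_iff[OF M s Q] assms(4) by simp

lemma Pr_Not:
  assumes M: "markov_chain M" and s: "s \<in> states M" and Q: "Measurable.pred (path_space M) Q"
  shows "Pr M s (\<lambda>\<pi>. \<not> Q \<pi>) = 1 - Pr M s Q"
proof -
  interpret prob_space "path_measure M s" by (rule prob_space_path_measure[OF M s])
  have 1: "Measurable.pred (path_space M) (\<lambda>\<pi>. \<not> Q \<pi>)" using Q by measurable
  show ?thesis
    unfolding Pr_eq_measure[OF M s Q] Pr_eq_measure[OF M s 1]
    using prob_neg[of Q] Q pred_path_measure_iff[OF M s, of Q]
    by (simp add: pred_def flip: space_path_measure[OF M s])
qed

section \<open>Until and release probabilities\<close>

lemma pred_sat_until [measurable]: "Measurable.pred (path_space M) (sat_until A B)"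
  unfolding sat_until_def[abs_def] by measurable

text \<open>The expansion law of until, phrased by prepending a state so as to fit the first-step
  decomposition.\<close>

lemma sat_until_case_nat:
  "sat_until A B (case_nat s \<pi>) \<longleftrightarrow> s \<in> B \<or> s \<in> A \<and> sat_until A B \<pi>"
proof
  assume "sat_until A B (case_nat s \<pi>)"
  then obtain i where "case_nat s \<pi> i \<in> B" "\<forall>j<i. case_nat s \<pi> j \<in> A" by (auto simp: sat_until_def)
  then show "s \<in> B \<or> s \<in> A \<and> sat_until A B \<pi>"
    by (cases i) (force simp: sat_until_def All_less_Suc2)+
next
  assume "s \<in> B \<or> s \<in> A \<and> sat_until A B \<pi>"
  then show "sat_until A B (case_nat s \<pi>)"
  proof
    assume "s \<in> B"
    then show ?thesis by (auto simp: sat_until_def intro!: exI[of _ 0])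
  next
    assume "s \<in> A \<and> sat_until A B \<pi>"
    then obtain i where "s \<in> A" "\<pi> i \<in> B" "\<forall>j<i. \<pi> j \<in> A" by (auto simp: sat_until_def)
    then show ?thesis
      unfolding sat_until_def All_less_Suc2[symmetric] by (intro exI[of _ "Suc i"]) (simp add: All_less_Suc2)
  qed
qed

lemma Pr_until_step:
  assumes M: "markov_chain M" and s: "s \<in> states M" and "s \<in> A" "s \<notin> B"
  shows "Pr M s (sat_until A B) = (\<Sum>t\<in>states M. tprob M s t * Pr M t (sat_until A B))"
  unfolding Pr_eq_measure[OF M s pred_sat_until] measure_path_measure_step[OF M s pred_sat_until]
  using assms by (intro sum.cong refl) (simp add: sat_until_case_nat Pr_eq_measure[OF M _ pred_sat_until])

lemma Pr_until_target:
  assumes M: "markov_chain M" and s: "s \<in> states M" and "s \<in> B"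
  shows "Pr M s (sat_until A B) = 1"
proof (rule Pr_AE_True[OF M s pred_sat_until])
  show "AE \<pi> in path_measure M s. sat_until A B \<pi>"
    using path_measure_initial[OF M s]
    by eventually_elim (use assms(3) in \<open>auto simp: sat_until_def intro!: exI[of _ 0]\<close>)
qed

lemma Pr_until_blocked:
  assumes M: "markov_chain M" and s: "s \<in> states M" and "s \<notin> A" "s \<notin> B"
  shows "Pr M s (sat_until A B) = 0"
proof (rule Pr_AE_False[OF M s pred_sat_until])
  show "AE \<pi> in path_measure M s. \<not> sat_until A B \<pi>"
    using path_measure_initial[OF M s]
    by eventually_elim (use assms(3,4) in \<open>auto simp: sat_until_def, metis gr0I\<close>)
qed

lemma Pr_until_unreachable:
  assumes M: "markov_chain M" and s: "s \<in> states M" and "B \<inter> states M = {}"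
  shows "Pr M s (sat_until A B) = 0"
proof (rule Pr_AE_False[OF M s pred_sat_until])
  show "AE \<pi> in path_measure M s. \<not> sat_until A B \<pi>"
    using AE_path_measure_paths[OF M s]
    by eventually_elim (use assms(3) in \<open>auto simp: sat_until_def paths_def image_subset_iff\<close>)
qed

text \<open>Release is dual to until, which reduces all later work to until. Conversely, the first
  position outside \<open>B\<close> must come strictly after one in \<open>A\<close>, since
  otherwise it would witness the excluded until.\<close>

lemma sat_release_iff_not_until: "sat_release A B \<pi> \<longleftrightarrow> \<not> sat_until (- A) (- B) \<pi>"
proof
  assume "sat_release A B \<pi>"
  then consider i where "\<pi> i \<in> A \<inter> B" "\<forall>j<i. \<pi> j \<in> B" | "\<forall>j. \<pi> j \<in> B"
    by (auto simp: sat_release_def sat_until_def)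
  then show "\<not> sat_until (- A) (- B) \<pi>"
    by cases (auto simp: sat_until_def, metis IntD1 IntD2 linorder_neqE_nat)
next
  assume *: "\<not> sat_until (- A) (- B) \<pi>"
  show "sat_release A B \<pi>"
  proof (cases "\<forall>j. \<pi> j \<in> B")
    case False
    define k where "k = (LEAST k. \<pi> k \<notin> B)"
    have k: "\<pi> k \<notin> B" using False LeastI_ex[of "\<lambda>k. \<pi> k \<notin> B"] by (auto simp: k_def)
    have below: "\<pi> j \<in> B" if "j < k" for j
      using not_less_Least[of j "\<lambda>k. \<pi> k \<notin> B"] that by (auto simp: k_def)
    from * k   obtain i where "i < k" "\<pi> i \<in> A" by (auto simp: sat_until_def)
    then show ?thesis using below by (auto simp: sat_release_def sat_until_def)
  qed (simp add: sat_release_def)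
qed

lemma Pr_release:
  assumes "markov_chain M" "s \<in> states M"
  shows "Pr M s (sat_release A B) = 1 - Pr M s (sat_until (- A) (- B))"
  using Pr_Not[OF assms pred_sat_until, of "- A" "- B"] by (simp add: sat_release_iff_not_until[abs_def])


section \<open>Ladder chains\<close>

text \<open>Truncated subtraction makes 0 its own successor, so both ends of the ladder
  loop.\<close>

definition down :: "nat \<Rightarrow> nat \<Rightarrow> nat" where
  "down n i = (if i = n then n else i - 1)"

text \<open>
  The weights \<open>jump \<eta> n i\<close> for \<open>i \<ge> m\<close> sum to \<open>\<eta> ^ m\<close>, so the first of them carries the
  fraction \<open>1 - \<eta>\<close> of the tail.
\<close>

definition jump :: "real \<Rightarrow> nat \<Rightarrow> nat \<Rightarrow> real" where
  "jump \<eta> n i = (if i < n then (1 - \<eta>) * \<eta> ^ i else \<eta> ^ n)"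

definition ladder :: "'a \<Rightarrow> real \<Rightarrow> nat \<Rightarrow> (nat, 'a) mchain" where
  "ladder a \<eta> n = \<lparr>states = {..n}, tprob = \<lambda>i j. (of_bool (j = down n i) + jump \<eta> n j) / 2,
     label = \<lambda>i. if i = 0 then {} else {a}\<rparr>"

lemma states_ladder [simp]: "states (ladder a \<eta> n) = {..n}"
  and label_ladder [simp]: "label (ladder a \<eta> n) i = (if i = 0 then {} else {a})"
  by (simp_all add: ladder_def)

lemma down_le: "i \<le> n \<Longrightarrow> down n i \<le> n"
  by (auto simp: down_def)

lemma jump_pos: "0 < \<eta> \<Longrightarrow> \<eta> < 1 \<Longrightarrow> 0 < jump \<eta> n i"
  by (simp add: jump_def)

lemma sum_jump_tail: "m \<le> n \<Longrightarrow> (\<Sum>i\<in>{m..n}. jump \<eta> n i) = \<eta> ^ m"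
proof (induction rule: inc_induct)
  case base
  show ?case by (simp add: jump_def)
next
  case (step m)
  then have "(\<Sum>i\<in>{m..n}. jump \<eta> n i) = jump \<eta> n m + (\<Sum>i\<in>{Suc m..n}. jump \<eta> n i)"
    by (intro sum.atLeast_Suc_atMost) simp
  with step show ?case by (simp add: jump_def algebra_simps)
qed

lemma sum_jump: "(\<Sum>i\<le>n. jump \<eta> n i) = 1"
  using sum_jump_tail[of 0 n \<eta>] by (simp add: atMost_atLeast0)

text \<open>The second summand is the same for every source state \<open>i\<close>. Hence an until
  probability satisfies a recursion along the ladder that involves the other states only through one
  common average.\<close>

lemma sum_tprob_ladder:
  assumes "i \<le> n"
  shows "(\<Sum>j\<le>n. tprob (ladder a \<eta> n) i j * f j) = (f (down n i) + (\<Sum>j\<le>n. jump \<eta> n j * f j)) / 2"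
proof -
  have "(\<Sum>j\<le>n. tprob (ladder a \<eta> n) i j * f j) =
      (\<Sum>j\<le>n. (if j = down n i then f j else 0) / 2 + jump \<eta> n j * f j / 2)"
    by (intro sum.cong refl) (simp add: ladder_def add_divide_distrib distrib_right)
  also have "\<dots> = (\<Sum>j\<le>n. if j = down n i then f j else 0) / 2 + (\<Sum>j\<le>n. jump \<eta> n j * f j) / 2"
    by (simp only: sum.distrib sum_divide_distrib)
  also have "(\<Sum>j\<le>n. if j = down n i then f j else 0) = f (down n i)"
    using down_le[OF assms] by simp
  finally show ?thesis by (simp add: add_divide_distrib)
qed

lemma sum_tprob_ladder_subset:
  assumes "i \<le> n" "A \<subseteq> {..n}"
  shows "(\<Sum>j\<in>A. tprob (ladder a \<eta> n) i j) = (of_bool (down n i \<in> A) + (\<Sum>j\<in>A. jump \<eta> n j)) / 2"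
proof -
  have eq: "(\<Sum>j\<in>A. h j) = (\<Sum>j\<le>n. h j * of_bool (j \<in> A))" for h :: "nat \<Rightarrow> real"
    using assms(2) by (intro sum.mono_neutral_cong_left) auto
  show ?thesis unfolding eq by (rule sum_tprob_ladder[OF assms(1)])
qed

lemma markov_chain_ladder:
  assumes "0 < \<eta>" "\<eta> < 1"
  shows "markov_chain (ladder a \<eta> n)"
proof -
  have total: "(\<Sum>j\<le>n. tprob (ladder a \<eta> n) i j) = 1" if "i \<le> n" for i
    using sum_tprob_ladder[OF that, of a \<eta> "\<lambda>_. 1"] by (simp add: sum_jump)
  have nonneg: "0 \<le> tprob (ladder a \<eta> n) i j" for i j
    using jump_pos[OF assms, of n j] by (simp add: ladder_def)
  have "tprob (ladder a \<eta> n) i j \<le> 1" if "i \<le> n" "j \<le> n" for i j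
    using member_le_sum[of j "{..n}" "tprob (ladder a \<eta> n) i"] nonneg that total by simp
  then show ?thesis using nonneg total by (simp add: markov_chain_def)
qed

section \<open>The nu-formula on ladders\<close>

lemma ladder_top_mem_nu:
  assumes \<eta>: "0 < \<eta>" "\<eta> < 1" and n: "0 < n"
  shows "n \<in> pmu_sem_closed (ladder a \<eta> n) (Nu Z (MAnd (MAtom a) (MNext GreaterEq 0.5 (MVar Z))))"
proof -
  let ?F = "\<lambda>X. {s \<in> {..n}. a \<in> label (ladder a \<eta> n) s} \<inter> next_sem (ladder a \<eta> n) GreaterEq 0.5 (X \<inter> {..n})"
  have "tprob (ladder a \<eta> n) n n \<ge> 1 / 2"
    using jump_pos[OF \<eta>, of n n] by (simp add: ladder_def down_def)
  \<comment> \<open>The loop at the top alone reaches the threshold 1/2, so \<open>{n}\<close> is a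
    post-fixpoint.\<close>
  then have "{n} \<subseteq> ?F {n}" using n by (simp add: next_sem_def)
  then have "{n} \<subseteq> gfp ?F" by (rule gfp_upperbound)
  then show ?thesis by (simp add: pmu_sem_closed_def)
qed

text \<open>Non-membership climbs the ladder from 0, where \<open>a\<close> fails: a state whose
  lower neighbour lies outside the fixpoint can enter it only by a jump.\<close>

lemma ladder_below_notin_nu:
  assumes \<eta>: "0 < \<eta>" "\<eta> < 1" and "i < n"
  shows "i \<notin> pmu_sem_closed (ladder a \<eta> n) (Nu Z (MAnd (MAtom a) (MNext GreaterEq 0.5 (MVar Z))))"
proof -
  let ?M = "ladder a \<eta> n" let ?f = "MAnd (MAtom a) (MNext GreaterEq 0.5 (MVar Z))"
  define X where "X = pmu_sem_closed ?M (Nu Z ?f)"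
  have unfold: "X = pmu_sem ?M ((\<lambda>_. {})(Z := X)) ?f"
    unfolding X_def pmu_sem_closed_def pmu_sem.simps(10)
    by (rule gfp_unfold[OF pmu_sem_fixpoint_mono[OF markov_chain_ladder[OF \<eta>]]])
  have X: "X \<subseteq> {..n} - {0}" by (subst unfold) auto
  \<comment> \<open>As 0 is outside \<open>X\<close> but carries positive jump weight, jumps alone
    give strictly less than 1/2 after halving.\<close>
  have "(\<Sum>j\<in>X. jump \<eta> n j) \<le> (\<Sum>j\<in>{..n} - {0}. jump \<eta> n j)"
    using X jump_pos[OF \<eta>] by (intro sum_mono2) (auto intro: less_imp_le)
  also have "\<dots> = 1 - jump \<eta> n 0" by (simp add: sum_diff1 sum_jump)
  finally have small: "(\<Sum>j\<in>X. jump \<eta> n j) < 1" using jump_pos[OF \<eta>, of n 0] by simp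
  have "i \<notin> X" using \<open>i < n\<close>
  proof (induction i)
    case 0
    show ?case using X by auto
  next
    case (Suc i)
    then have "down n (Suc i) \<notin> X" by (simp add: down_def)
    then have "(\<Sum>j\<in>X. tprob ?M (Suc i) j) < 1 / 2"
      using sum_tprob_ladder_subset[of "Suc i" n X a \<eta>] X[THEN subset_trans, of "{..n}"] Suc.prems small
      by auto
    moreover have "X \<inter> {..n} = X" using X by auto
    ultimately show ?case by (subst unfold) (simp add: next_sem_def)
  qed
  then show ?thesis by (simp add: X_def)
qed

section \<open>Until probabilities on high rungs\<close>

text \<open>All indices share one of four cases. The exact values 0 and 1 are kept apart from values
  merely near them because the thresholds \<open>> 0\<close> and \<open>\<ge> 1\<close> can tell
  these apart.\<close>

definition settled :: "real \<Rightarrow> nat set \<Rightarrow> (nat \<Rightarrow> real) \<Rightarrow> bool" where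
  "settled \<delta> I P \<longleftrightarrow> (\<forall>i\<in>I. P i = 0) \<or> (\<forall>i\<in>I. 0 < P i \<and> P i \<le> \<delta>) \<or>
     (\<forall>i\<in>I. 1 - \<delta> \<le> P i \<and> P i < 1) \<or> (\<forall>i\<in>I. P i = 1)"

lemma settled_compl: "settled \<delta> I P \<Longrightarrow> settled \<delta> I (\<lambda>i. 1 - P i)"
  unfolding settled_def by auto

text \<open>Within one case the values lie on the same side of any threshold in the gap between
  \<open>\<delta>\<close> and \<open>1 - \<delta>\<close>. At the thresholds 0 and 1 only being
  exactly 0 or exactly 1 matters.\<close>

lemma settled_cmp_holds:
  assumes "settled \<delta> I P" "i \<in> I" "j \<in> I"
    and "p = 0 \<or> p = 1 \<or> \<delta> < p \<and> p < 1 - \<delta>" "0 < \<delta>" "\<delta> < 1"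
  shows "cmp_holds c (P i) p \<longleftrightarrow> cmp_holds c (P j) p"
proof -
  from assms(1-3) consider "P i = 0" "P j = 0" | "0 < P i" "P i \<le> \<delta>" "0 < P j" "P j \<le> \<delta>"
    | "1 - \<delta> \<le> P i" "P i < 1" "1 - \<delta> \<le> P j" "P j < 1" | "P i = 1" "P j = 1"
    unfolding settled_def by metis
  then show ?thesis
    by cases (use assms(4-6) in \<open>(cases c; elim disjE; simp)+\<close>)
qed

text \<open>
  The least state \<open>m\<close> with a determined value fixes the average \<open>R\<close> of \<open>P\<close> under \<open>jump\<close>
  up to \<open>\<eta>\<close>: all smaller states have value \<open>R\<close> as well, and \<open>m\<close> carries the fraction
  \<open>1 - \<eta>\<close> of the weight of the remaining ones. High up the ladder \<open>P\<close> converges to \<open>R\<close>.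
\<close>

lemma settled_harmonic:
  assumes \<eta>: "0 < \<eta>" "\<eta> < 1" and K: "(1 / 2) ^ K \<le> \<eta>"
    and bounds: "\<And>i. i \<le> n \<Longrightarrow> 0 \<le> P i \<and> P i \<le> 1"
    and R: "R = (\<Sum>j\<le>n. jump \<eta> n j * P j)"
    and harmonic: "\<And>i. i \<le> n \<Longrightarrow> i \<in> H \<Longrightarrow> P i = (P (down n i) + R) / 2"
    and determined: "\<And>i. i \<le> n \<Longrightarrow> i \<notin> H \<Longrightarrow> P i = 0 \<or> P i = 1"
    and high: "\<And>i. N \<le> i \<Longrightarrow> i \<le> n \<Longrightarrow> i \<in> H"
    and ex: "\<exists>m\<le>n. m \<notin> H"
  shows "settled (2 * \<eta>) {N + K..n} P"
proof (cases "N \<le> n")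
  case False
  then show ?thesis by (simp add: settled_def)
next
  case True
  define m where "m = (LEAST m. m \<notin> H)"
  obtain m' where m': "m' \<le> n" "m' \<notin> H" using ex by blast
  have mH: "m \<notin> H" unfolding m_def using m'(2) by (rule LeastI)
  have "m \<le> m'" unfolding m_def using m'(2) by (rule Least_le)
  with m'(1) have "m \<le> n" by simp
  moreover have "m \<noteq> n" using high[OF True] mH by auto
  \<comment> \<open>Strictness puts \<open>m\<close> in the geometric branch of \<open>jump\<close>
    rather than on the leftover mass at \<open>n\<close>.\<close>
  ultimately have mn: "m < n" by simp
  have below: "s \<in> H" if "s < m" for s using that not_less_Least unfolding m_def by blast
  \<comment> \<open>The loop at 0 gives \<open>P 0 = (P 0 + R) / 2\<close>, hence
    \<open>P 0 = R\<close>; each further rung averages \<open>R\<close> with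
    \<open>R\<close>.\<close>
  have PR: "P s = R" if "s < m" for s
    using that
  proof (induction s)
    case 0
    then show ?case using harmonic[of 0] below[of 0] mn by (simp add: down_def)
  next
    case (Suc s)
    then show ?case using harmonic[of "Suc s"] below[of "Suc s"] mn by (simp add: down_def)
  qed
  have R01: "0 \<le> R" "R \<le> 1"
  proof -
    show "0 \<le> R" unfolding R using bounds jump_pos[OF \<eta>] by (intro sum_nonneg) (simp add: less_imp_le)
    have "R \<le> (\<Sum>j\<le>n. jump \<eta> n j)" unfolding R
      using bounds jump_pos[OF \<eta>] by (intro sum_mono mult_left_le) (simp_all add: less_imp_le)
    then show "R \<le> 1" by (simp add: sum_jump)
  qed
  have tail: "(\<Sum>j\<in>{Suc m..n}. jump \<eta> n j) = \<eta> * \<eta> ^ m"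
    using sum_jump_tail[of "Suc m" n \<eta>] mn by simp
  \<comment> \<open>Deviations from the mean \<open>R\<close> cancel under \<open>jump\<close>, and
    those below \<open>m\<close> vanish.\<close>
  have balance: "(1 - \<eta>) * \<eta> ^ m * (P m - R) + (\<Sum>j\<in>{Suc m..n}. jump \<eta> n j * (P j - R)) = 0"
  proof -
    have "(\<Sum>j\<le>n. jump \<eta> n j * (P j - R)) = 0"
      unfolding right_diff_distrib sum_subtractf by (simp add: R sum_distrib_right[symmetric] sum_jump)
    moreover have "(\<Sum>j\<le>n. jump \<eta> n j * (P j - R)) = (\<Sum>j\<in>{m..n}. jump \<eta> n j * (P j - R))"
      by (intro sum.mono_neutral_right) (auto simp: PR)
    moreover have "\<dots> = jump \<eta> n m * (P m - R) + (\<Sum>j\<in>{Suc m..n}. jump \<eta> n j * (P j - R))"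
      using mn by (intro sum.atLeast_Suc_atMost) simp
    ultimately show ?thesis using mn by (simp add: jump_def)
  qed
  have \<eta>m: "0 < \<eta> ^ m" using \<eta> by simp
  \<comment> \<open>If \<open>P m = 0\<close>, the deficit \<open>(1 - \<eta>) * R\<close> at
    \<open>m\<close> must be compensated by the states above, which offer at most
    \<open>\<eta> * (1 - R)\<close> (both up to the factor \<open>\<eta> ^ m\<close>); this gives
    \<open>R \<le> \<eta>\<close>. The case \<open>P m = 1\<close> is symmetric.\<close>
  have dichotomy: "R \<le> \<eta> \<or> 1 - \<eta> \<le> R"
    using determined[OF \<open>m \<le> n\<close> mH]
  proof
    assume "P m = 0"
    have "(\<Sum>j\<in>{Suc m..n}. jump \<eta> n j * (P j - R)) \<le> (\<Sum>j\<in>{Suc m..n}. jump \<eta> n j * (1 - R))"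
      using bounds jump_pos[OF \<eta>] by (intro sum_mono mult_left_mono) (simp_all add: less_imp_le)
    also have "\<dots> = \<eta> * \<eta> ^ m * (1 - R)" by (simp add: tail flip: sum_distrib_right)
    finally have "0 \<le> \<eta> ^ m * (\<eta> - R)" using balance \<open>P m = 0\<close> by (simp add: algebra_simps)
    then show ?thesis using \<eta>m by (simp add: zero_le_mult_iff)
  next
    assume "P m = 1"
    have "\<eta> * \<eta> ^ m * (0 - R) = (\<Sum>j\<in>{Suc m..n}. jump \<eta> n j * (0 - R))"
      by (simp only: tail flip: sum_distrib_right)
    also have "\<dots> \<le> (\<Sum>j\<in>{Suc m..n}. jump \<eta> n j * (P j - R))"
      using bounds jump_pos[OF \<eta>] by (intro sum_mono mult_left_mono) (simp_all add: less_imp_le)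
    finally have "0 \<le> \<eta> ^ m * (R - (1 - \<eta>))" using balance \<open>P m = 1\<close> by (simp add: algebra_simps)
    then show ?thesis using \<eta>m by (simp add: zero_le_mult_iff)
  qed
  have top: "P n = R" using harmonic[of n] high[OF True] by (simp add: down_def)
  \<comment> \<open>Each rung halves the distance to \<open>R\<close>. The top is treated apart
    because it follows itself instead of the rung below; there the distance is 0.\<close>
  have converge: "\<bar>P (N + k) - R\<bar> \<le> (1 / 2) ^ k" if "N + k \<le> n" for k
    using that
  proof (induction k)
    case 0
    then show ?case using bounds[of N] R01 by auto
  next
    case (Suc k)
    show ?case
    proof (cases "N + Suc k = n")
      case True
      then show ?thesis by (simp add: top)
    next
      case False
      then have "P (N + Suc k) - R = (P (N + k) - R) / 2"
        using harmonic[of "N + Suc k"] high[of "N + Suc k"] Suc.prems by (simp add: down_def field_simps)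
      then have "\<bar>P (N + Suc k) - R\<bar> = \<bar>P (N + k) - R\<bar> / 2"
        by (simp only: abs_divide abs_numeral)
      then show ?thesis using Suc by simp
    qed
  qed
  have close: "\<bar>P i - R\<bar> \<le> \<eta>" if i: "i \<in> {N + K..n}" for i
  proof -
    have "\<bar>P i - R\<bar> \<le> (1 / 2) ^ (i - N)" using converge[of "i - N"] i by simp
    also have "\<dots> \<le> (1 / 2) ^ K" using i by (intro power_decreasing) auto
    finally show ?thesis using K by simp
  qed
  have Pi: "P i = (P (down n i) + R) / 2" if "i \<in> {N + K..n}" for i
    using that by (intro harmonic high) auto
  have down_bounds: "0 \<le> P (down n i)" "P (down n i) \<le> 1" if "i \<in> {N + K..n}" for i
    using bounds[OF down_le[of i n]] that by auto
  have jump_nz: "jump \<eta> n j \<noteq> 0" for j using jump_pos[OF \<eta>, of n j] by simp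
  \<comment> \<open>All jump weights are positive, so an average of 0 or 1 forces this value
    everywhere. Otherwise averaging with \<open>R\<close> keeps \<open>P\<close> strictly between 0
    and 1.\<close>
  consider "R = 0" | "R = 1" | "0 < R" "R < 1" using R01 by fastforce
  then show ?thesis
  proof cases
    case 1
    have "\<forall>j\<in>{..n}. jump \<eta> n j * P j = 0"
      using 1 bounds jump_pos[OF \<eta>] unfolding R by (subst (asm) sum_nonneg_eq_0_iff) (simp_all add: less_imp_le)
    then have "\<forall>j\<le>n. P j = 0" using jump_nz by simp
    then show ?thesis by (simp add: settled_def)
  next
    case 2
    have "(\<Sum>j\<le>n. jump \<eta> n j * (1 - P j)) = 0"
      using 2 unfolding right_diff_distrib sum_subtractf by (simp add: sum_jump flip: R)
    then have "\<forall>j\<in>{..n}. jump \<eta> n j * (1 - P j) = 0"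
      using bounds jump_pos[OF \<eta>] by (subst (asm) sum_nonneg_eq_0_iff) (simp_all add: less_imp_le)
    then have "\<forall>j\<le>n. P j = 1" using jump_nz by simp
    then show ?thesis by (simp add: settled_def)
  next
    case 3
    have "0 < P i" "P i < 1" if "i \<in> {N + K..n}" for i
      using Pi[OF that] down_bounds[OF that] 3 by auto
    \<comment> \<open>One \<open>\<eta>\<close> accounts for the distance of \<open>P i\<close> to
      \<open>R\<close>, the other for that of \<open>R\<close> to 0 or 1.\<close>
    moreover have "\<forall>i\<in>{N + K..n}. P i \<le> 2 * \<eta>" if "R \<le> \<eta>"
      using close that by (fastforce simp: abs_le_iff)
    moreover have "\<forall>i\<in>{N + K..n}. 1 - 2 * \<eta> \<le> P i" if "1 - \<eta> \<le> R"
      using close that by (fastforce simp: abs_le_iff)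
    ultimately show ?thesis using dichotomy unfolding settled_def by blast
  qed
qed

text \<open>High states lie all in \<open>B\<close>, all outside both sets, or all in
  \<open>A - B\<close>. In the last case the probabilities are harmonic on \<open>A - B\<close>, and
  some state outside it anchors them at 0 or 1; if there is no such state, \<open>B\<close> is never
  reached.\<close>

lemma settled_Pr_until:
  assumes \<eta>: "0 < \<eta>" "\<eta> < 1" and K: "(1 / 2) ^ K \<le> \<eta>"
    and A: "\<forall>i\<in>{N..n}. \<forall>j\<in>{N..n}. i \<in> A \<longleftrightarrow> j \<in> A"
    and B: "\<forall>i\<in>{N..n}. \<forall>j\<in>{N..n}. i \<in> B \<longleftrightarrow> j \<in> B"
  shows "settled (2 * \<eta>) {N + K..n} (\<lambda>i. Pr (ladder a \<eta> n) i (sat_until A B))"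
proof -
  let ?M = "ladder a \<eta> n"
  have M: "markov_chain ?M" by (rule markov_chain_ladder[OF \<eta>])
  define P where "P i = Pr ?M i (sat_until A B)" for i
  have target: "P i = 1" if "i \<le> n" "i \<in> B" for i
    unfolding P_def using that by (intro Pr_until_target[OF M]) auto
  have blocked: "P i = 0" if "i \<le> n" "i \<notin> A \<union> B" for i
    unfolding P_def using that by (intro Pr_until_blocked[OF M]) auto
  have step: "P i = (P (down n i) + (\<Sum>j\<le>n. jump \<eta> n j * P j)) / 2" if "i \<le> n" "i \<in> A - B" for i
    unfolding P_def using that Pr_until_step[OF M, of i A B] by (simp add: sum_tprob_ladder)
  consider "\<forall>i\<in>{N..n}. i \<in> B" | "\<forall>i\<in>{N..n}. i \<notin> A \<union> B" | "\<forall>i\<in>{N..n}. i \<in> A - B" "\<exists>m\<le>n. m \<notin> A - B"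
    | "\<forall>i\<le>n. i \<in> A - B"
    using A B by blast
  then have "settled (2 * \<eta>) {N + K..n} P"
  proof cases
    case 1
    then have "\<forall>i\<in>{N + K..n}. P i = 1" by (auto intro: target)
    then show ?thesis by (simp add: settled_def)
  next
    case 2
    then have "\<forall>i\<in>{N + K..n}. P i = 0" by (auto intro: blocked)
    then show ?thesis by (simp add: settled_def)
  next
    case 3
    show ?thesis
    proof (rule settled_harmonic[OF \<eta> K _ refl, where H = "A - B"])
      show "0 \<le> P i \<and> P i \<le> 1" if "i \<le> n" for i
        unfolding P_def using Pr_bounds[OF M, of i] that by simp
    qed (use 3 step target blocked in auto)
  next
    case 4
    then have "P i = 0" if "i \<le> n" for i
      unfolding P_def using that by (intro Pr_until_unreachable[OF M]) auto
    then show ?thesis by (simp add: settled_def)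
  qed
  then show ?thesis by (simp add: P_def[abs_def])
qed

section \<open>PCTL formulas on high rungs\<close>

lemma pctl_sem_subset: "pctl_sem M g \<subseteq> states M"
  by (induction g) (auto simp: next_sem_def)

definition agree :: "'a \<Rightarrow> real \<Rightarrow> nat \<Rightarrow> nat \<Rightarrow> 'a pctl \<Rightarrow> bool" where
  "agree a \<eta> N n g \<longleftrightarrow> (\<forall>i\<in>{N..n}. \<forall>j\<in>{N..n}. i \<in> pctl_sem (ladder a \<eta> n) g \<longleftrightarrow> j \<in> pctl_sem (ladder a \<eta> n) g)"

lemma agree_mono: "agree a \<eta> N n g \<Longrightarrow> N \<le> N' \<Longrightarrow> agree a \<eta> N' n g"
  by (auto simp: agree_def)

lemma agree_PAnd_POr:
  assumes "agree a \<eta> N n g1" "agree a \<eta> N n g2"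
  shows "agree a \<eta> N n (PAnd g1 g2)" "agree a \<eta> N n (POr g1 g2)"
  using assms unfolding agree_def pctl_sem.simps Int_iff Un_iff by blast+

lemma eventually_agree_common:
  assumes "eventually (\<lambda>\<eta>. \<exists>N. \<forall>n. agree a \<eta> N n g1) F"
    and "eventually (\<lambda>\<eta>. \<exists>N. \<forall>n. agree a \<eta> N n g2) F"
  shows "eventually (\<lambda>\<eta>. \<exists>N. \<forall>n. agree a \<eta> N n g1 \<and> agree a \<eta> N n g2) F"
  using assms
proof eventually_elim
  case (elim \<eta>)
  then obtain N1 N2 where N: "agree a \<eta> N1 n g1" "agree a \<eta> N2 n g2" for n by blast
  have "agree a \<eta> (max N1 N2) n g1 \<and> agree a \<eta> (max N1 N2) n g2" for n
    using agree_mono[OF N(1), of "max N1 N2" n] agree_mono[OF N(2), of "max N1 N2" n] by simp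
  then show ?case by blast
qed

text \<open>One rung is lost because the step down must stay in the range of agreement; the jump
  part does not depend on the source.\<close>

lemma agree_PNext:
  assumes "agree a \<eta> N n g"
  shows "agree a \<eta> (Suc N) n (PNext c p g)"
proof -
  let ?G = "pctl_sem (ladder a \<eta> n) g"
  have "i \<in> pctl_sem (ladder a \<eta> n) (PNext c p g) \<longleftrightarrow> j \<in> pctl_sem (ladder a \<eta> n) (PNext c p g)"
    if "i \<in> {Suc N..n}" "j \<in> {Suc N..n}" for i j
  proof -
    have "down n i \<in> {N..n}" "down n j \<in> {N..n}" using that by (auto simp: down_def)
    then have "down n i \<in> ?G \<longleftrightarrow> down n j \<in> ?G" using assms unfolding agree_def by blast
    moreover have "?G \<subseteq> {..n}" using pctl_sem_subset[of "ladder a \<eta> n" g] by simp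
    ultimately have "(\<Sum>t\<in>?G. tprob (ladder a \<eta> n) i t) = (\<Sum>t\<in>?G. tprob (ladder a \<eta> n) j t)"
      using that by (simp add: sum_tprob_ladder_subset)
    then show ?thesis using that by (simp add: next_sem_def)
  qed
  then show ?thesis unfolding agree_def by blast
qed

lemma agree_PUntil_PRelease:
  assumes \<eta>: "0 < \<eta>" "2 * \<eta> < 1" and K: "(1 / 2) ^ K \<le> \<eta>"
    and p: "p = 0 \<or> p = 1 \<or> 2 * \<eta> < p \<and> p < 1 - 2 * \<eta>"
    and g: "agree a \<eta> N n g1" "agree a \<eta> N n g2"
  shows "agree a \<eta> (N + K) n (PUntil c p g1 g2)" "agree a \<eta> (N + K) n (PRelease c p g1 g2)"
proof -
  let ?M = "ladder a \<eta> n" let ?A = "pctl_sem ?M g1" and ?B = "pctl_sem ?M g2"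
  have \<eta>1: "\<eta> < 1" using \<eta> by simp
  have U: "settled (2 * \<eta>) {N + K..n} (\<lambda>i. Pr ?M i (sat_until ?A ?B))"
    using g unfolding agree_def by (intro settled_Pr_until[OF \<eta>(1) \<eta>1 K])
  \<comment> \<open>Agreement of high states passes to complements, so duality turns the until bound
    into one for release.\<close>
  have "settled (2 * \<eta>) {N + K..n} (\<lambda>i. 1 - Pr ?M i (sat_until (- ?A) (- ?B)))"
    using g unfolding agree_def by (intro settled_compl settled_Pr_until[OF \<eta>(1) \<eta>1 K]) blast+
  then have V: "settled (2 * \<eta>) {N + K..n} (\<lambda>i. Pr ?M i (sat_release ?A ?B))"
    unfolding settled_def by (simp add: Pr_release[OF markov_chain_ladder[OF \<eta>(1) \<eta>1]])
  have \<delta>: "0 < 2 * \<eta>" using \<eta> by simp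
  note U' = settled_cmp_holds[OF U _ _ p \<delta> \<eta>(2)] and V' = settled_cmp_holds[OF V _ _ p \<delta> \<eta>(2)]
  show "agree a \<eta> (N + K) n (PUntil c p g1 g2)"
  proof (unfold agree_def, intro ballI)
    fix i j assume ij: "i \<in> {N + K..n}" "j \<in> {N + K..n}"
    show "i \<in> pctl_sem ?M (PUntil c p g1 g2) \<longleftrightarrow> j \<in> pctl_sem ?M (PUntil c p g1 g2)"
      using U'[OF ij, of c] ij by simp
  qed
  show "agree a \<eta> (N + K) n (PRelease c p g1 g2)"
  proof (unfold agree_def, intro ballI)
    fix i j assume ij: "i \<in> {N + K..n}" "j \<in> {N + K..n}"
    show "i \<in> pctl_sem ?M (PRelease c p g1 g2) \<longleftrightarrow> j \<in> pctl_sem ?M (PRelease c p g1 g2)"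
      using V'[OF ij, of c] ij by simp
  qed
qed

section \<open>Choice of the jump parameter and the contradiction\<close>

lemma eventually_threshold_gap:
  fixes p :: real
  assumes "p \<in> {0..1}"
  shows "eventually (\<lambda>\<eta>. p = 0 \<or> p = 1 \<or> 2 * \<eta> < p \<and> p < 1 - 2 * \<eta>) (at_right 0)"
proof (cases "p = 0 \<or> p = 1")
  case False
  with assms have "0 < min (p / 2) ((1 - p) / 2)" by auto
  then show ?thesis by (rule eventually_at_rightI[rotated]) auto
qed auto

lemma eventually_agree_PUntil_PRelease:
  assumes p: "p \<in> {0..1}"
    and IH: "eventually (\<lambda>\<eta>. \<exists>N. \<forall>n. agree a \<eta> N n g1) (at_right 0)"
      "eventually (\<lambda>\<eta>. \<exists>N. \<forall>n. agree a \<eta> N n g2) (at_right 0)"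
  shows "eventually (\<lambda>\<eta>. \<exists>N. \<forall>n. agree a \<eta> N n (PUntil c p g1 g2) \<and> agree a \<eta> N n (PRelease c p g1 g2)) (at_right 0)"
proof -
  have "eventually (\<lambda>\<eta>::real. 0 < \<eta> \<and> \<eta> < 1 / 2) (at_right 0)"
    by (rule eventually_at_rightI[of 0 "1 / 2"]) auto
  then show ?thesis
    using eventually_threshold_gap[OF p] eventually_agree_common[OF IH]
  proof eventually_elim
    case (elim \<eta>)
    then obtain N where N: "agree a \<eta> N n g1" "agree a \<eta> N n g2" for n by blast
    obtain K where K: "(1 / 2) ^ K < \<eta>" using real_arch_pow_inv[of \<eta> "1 / 2"] elim(1) by auto
    have "0 < \<eta>" "2 * \<eta> < 1" using elim(1) by simp_all
    from agree_PUntil_PRelease[OF this less_imp_le[OF K] elim(2) N] show ?case by blast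
  qed
qed

text \<open>The order of quantifiers matters: the thresholds in \<open>g\<close> bound
  \<open>\<eta>\<close> from above, then \<open>N\<close> may depend on \<open>g\<close> and
  \<open>\<eta>\<close>, but not on the height \<open>n\<close>. A filter at 0 collects the finitely
  many smallness conditions on \<open>\<eta>\<close>.\<close>

lemma eventually_agree:
  assumes "pctl_wf g"
  shows "eventually (\<lambda>\<eta>. \<exists>N. \<forall>n. agree a \<eta> N n g) (at_right 0)"
  using assms
proof (induction g)
  case (PAtom b)
  \<comment> \<open>From rung 1 on all labels coincide; only 0 lacks \<open>a\<close>.\<close>
  show ?case by (intro always_eventually allI exI[of _ 1]) (auto simp: agree_def)
next
  case (PNegAtom b)
  show ?case by (intro always_eventually allI exI[of _ 1]) (auto simp: agree_def)
next
  case (PNext c p g)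
  then have "eventually (\<lambda>\<eta>. \<exists>N. \<forall>n. agree a \<eta> N n g) (at_right 0)" by simp
  then show ?case by eventually_elim (metis agree_PNext)
next
  case (PAnd g1 g2)
  then have "eventually (\<lambda>\<eta>. \<exists>N. \<forall>n. agree a \<eta> N n g1 \<and> agree a \<eta> N n g2) (at_right 0)"
    by (intro eventually_agree_common) simp_all
  then show ?case by eventually_elim (metis agree_PAnd_POr)
next
  case (POr g1 g2)
  then have "eventually (\<lambda>\<eta>. \<exists>N. \<forall>n. agree a \<eta> N n g1 \<and> agree a \<eta> N n g2) (at_right 0)"
    by (intro eventually_agree_common) simp_all
  then show ?case by eventually_elim (metis agree_PAnd_POr)
next
  case (PUntil c p g1 g2)
  then have "eventually (\<lambda>\<eta>. \<exists>N. \<forall>n. agree a \<eta> N n (PUntil c p g1 g2) \<and> agree a \<eta> N n (PRelease c p g1 g2)) (at_right 0)"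
    by (intro eventually_agree_PUntil_PRelease) simp_all
  then show ?case by eventually_elim blast
next
  case (PRelease c p g1 g2)
  then have "eventually (\<lambda>\<eta>. \<exists>N. \<forall>n. agree a \<eta> N n (PUntil c p g1 g2) \<and> agree a \<eta> N n (PRelease c p g1 g2)) (at_right 0)"
    by (intro eventually_agree_PUntil_PRelease) simp_all
  then show ?case by eventually_elim blast
qed (auto simp: agree_def)

theorem theorem3:
  fixes a :: "'a::countable" and Z :: "'z::countable"
  shows "\<not> (\<exists>g :: 'a pctl. pctl_wf g \<and>
           (\<forall>M :: (nat, 'a) mchain. markov_chain M \<longrightarrow>
              pctl_sem M g =
              pmu_sem_closed M (Nu Z (MAnd (MAtom a) (MNext GreaterEq 0.5 (MVar Z))))))"
proof
  let ?f = "Nu Z (MAnd (MAtom a) (MNext GreaterEq 0.5 (MVar Z)))"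
  assume "\<exists>g :: 'a pctl. pctl_wf g \<and>
    (\<forall>M :: (nat, 'a) mchain. markov_chain M \<longrightarrow> pctl_sem M g = pmu_sem_closed M ?f)"
  then obtain g :: "'a pctl" where g: "pctl_wf g"
    and eq: "\<And>M :: (nat, 'a) mchain. markov_chain M \<Longrightarrow> pctl_sem M g = pmu_sem_closed M ?f"
    by blast
  have "eventually (\<lambda>\<eta>::real. 0 < \<eta> \<and> \<eta> < 1) (at_right 0)"
    by (rule eventually_at_rightI[of 0 1]) auto
  with eventually_agree[OF g, of a]
  have "eventually (\<lambda>\<eta>. (\<exists>N. \<forall>n. agree a \<eta> N n g) \<and> 0 < \<eta> \<and> \<eta> < 1) (at_right 0)"
    by (rule eventually_conj)
  then obtain \<eta> N where \<eta>: "0 < \<eta>" "\<eta> < 1" and N: "\<And>n. agree a \<eta> N n g"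
    using eventually_happens'[OF trivial_limit_at_right_real] by blast
  \<comment> \<open>With height \<open>Suc N\<close>, the range of agreement consists of exactly the
    top and the rung below it, which the nu-formula separates.\<close>
  have "N \<in> pctl_sem (ladder a \<eta> (Suc N)) g \<longleftrightarrow> Suc N \<in> pctl_sem (ladder a \<eta> (Suc N)) g"
    using N[of "Suc N"] unfolding agree_def by simp
  then show False
    unfolding eq[OF markov_chain_ladder[OF \<eta>]]
    using ladder_top_mem_nu[OF \<eta>, of "Suc N" a Z] ladder_below_notin_nu[OF \<eta>, of N "Suc N" a Z] by simp
qed

end
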